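(* Let $d \geq 1$ and let $a_1, \dots, a_m \in \mathbb{R}^d$ be distinct vectors of Euclidean norm one. Assume that \[ P = \{x \in \mathbb{R}^d : \langle a_i, x\rangle \leq 1 \text{ for } i = 1, \dots, m\} \] is bounded. Then \[ \mathrm{trace}\, A_\gamma(P) = \sum_{v \in \mathrm{vert}(P)} \nu_\gamma(v)\, |v|^2 \;\geq\; d + \frac{\pi}{4}(2d - m). \] Equality holds in this inequality if and only if $m = 2d$ and $P$ is an orthogonal image of $[-1,1]^d$ (that is, $P = U([-1,1]^d)$ for some orthogonal transformation $U$ of $\mathbb{R}^d$).
   Context: $|\cdot|$ and $\langle\cdot,\cdot\rangle$ are the Euclidean norm and inner product on $\mathbb{R}^d$. $\gamma_d$ is the standard Gaussian probability measure on $\mathbb{R}^d$, with density $(2\pi)^{-d/2} e^{-|x|^2/2}$. For a bounded full-dimensional polytope $P \subset \mathbb{R}^d$, $\mathrm{vert}(P)$ is its set of vertices; for $v \in \mathrm{vert}(P)$ its normal cone and Gaussian weight are \[ N_P(v) = \{p \in \mathbb{R}^d : \langle p, x - v\rangle \leq 0 \text{ for every } x \in P\}, \qquad \nu_\gamma(v) = \gamma_d(N_P(v)). \] The second moment operator of the Gaussian vertex measure is $A_\gamma(P) = \sum_{v \in \mathrm{vert}(P)} \nu_\gamma(v)\, v \otimes v$, where $(v \otimes v)x = \langle v, x\rangle v$. *)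

theory Defs
  imports "HOL-Analysis.Analysis"
begin

definition gauss_measure :: "(real ^ 'n) measure" where
  "gauss_measure =
     density lborel (\<lambda>x. ennreal ((2 * pi) powr (- real CARD('n) / 2) * exp (- ((norm x)\<^sup>2) / 2)))"

definition vert :: "(real ^ 'n) set \<Rightarrow> (real ^ 'n) set" where
  "vert P = {v. v extreme_point_of P}"

definition normal_cone :: "(real ^ 'n) set \<Rightarrow> real ^ 'n \<Rightarrow> (real ^ 'n) set" where
  "normal_cone P v = {p. \<forall>x\<in>P. p \<bullet> (x - v) \<le> 0}"

definition gauss_weight :: "(real ^ 'n) set \<Rightarrow> real ^ 'n \<Rightarrow> real" where
  "gauss_weight P v = measure gauss_measure (normal_cone P v)"

definition tensor_square :: "real ^ 'n \<Rightarrow> real ^ 'n \<Rightarrow> real ^ 'n" where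
  "tensor_square v x = (v \<bullet> x) *\<^sub>R v"

definition second_moment_operator :: "(real ^ 'n) set \<Rightarrow> real ^ 'n \<Rightarrow> real ^ 'n" where
  "second_moment_operator P x = (\<Sum>v\<in>vert P. gauss_weight P v *\<^sub>R tensor_square v x)"

text \<open>The library's trace is defined for square matrices only, so the trace of a linear operator
  is that of its matrix in the standard basis.\<close>

definition operator_trace :: "(real ^ 'n \<Rightarrow> real ^ 'n) \<Rightarrow> real" where
  "operator_trace T = trace (matrix T)"

end

theory Submission
  imports Defs "HOL-Probability.Probability"
begin

text \<open>
  Let \<gamma> be the Gaussian measure and d the dimension. Perturbing the right-hand sides of the constraints to
  1 + e^(i+1) with a small e > 0 makes P simple, and the normal fan of the perturbed polytope refines the
  normal fan of P into simplicial cones: each cone C is spanned by d of the vectors a_i, i \<in> I, and is contained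
  in the normal cone of the vertex v of P with a_i \<bullet> v = 1 for i \<in> I. For i \<in> I let D_i be the
  wedge C + \<real> a_i. The heart of the proof is an inequality for a single cone, \<open>cone_inequality\<close>:

    \<gamma>(C) |v|^2 + (\<pi>/4) \<Sum> \<gamma>(D_i) \<ge> d (1 + \<pi>/2) \<gamma>(C).

  The theorem follows by summation: the cones cover the space, and
      for a fixed i the wedges D_i of the cones that
  have a_i as a generator do not overlap, so that their measures add up to at most 1 for each of the m vectors.

  For a single cone use |v|^2 \<ge> 2 (v \<bullet> w) - |w|^2, where w is sqrt (\<pi>/2) times the Gaussian barycentre of C;
      if C
  is an orthant then w = v. In the coordinates x = \<Sum> t_i a_i this lower bound is a sum over i of
  expressions in the moments A_i = \<integral> t_i and S_i = \<integral> (a_i \<bullet> x) over C, and it remains to compare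
  each of them with P = \<gamma>(C) and \<theta>_i = \<gamma>(D_i) (\<open>cone_term_ge\<close>). Every line parallel to a_i inside D_i meets
  C in a ray, so one-dimensional integrals give S_i \<le> \<theta>_i / sqrt (2 \<pi>) and
  sqrt (2 \<pi>) A_i \<ge> \<theta>_i + \<pi> (P - \<theta>_i/2). These bounds leave the square (2 \<pi> - 4) (P - \<theta>_i/2)^2
  when \<theta>_i \<le> 4P. For larger \<theta>_i one needs in addition that A_i is not too large, namely A_i S_i \<le> P^2
  (\<open>moment_product_le\<close>): by the Prekopa-Leindler inequality \<gamma>(C + r a_i) is log-concave in r, hence bounded by
  P exp (- r S_i / P), and A_i is its integral over r \<ge> 0.

  Equality forces S_i = \<theta>_i / sqrt (2 \<pi>) for every cone
      and every i, which means that a_i is orthogonal to the other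
  generators of the cone. So all cones are orthants, all vertices v involved satisfy |v|^2
      = d, and comparing the two
  sides gives m = 2d. An orthant
      and its neighbour across the facet opposite to a_i share the other generators, so
  the neighbour is generated with - a_i (\<open>opposite_normal\<close>). The 2d vectors are therefore plus and minus an
  orthonormal basis, and P is a cube.
\<close>

section \<open>The Prekopa-Leindler inequality\<close>

text \<open>The one-dimensional Brunn-Minkowski inequality for midpoints. If a is close to the supremum
  of A and b is close to the infimum of B, then A + b lies to the left of a + b and a + B to the right
  of it, up to small sets; so the two translates are almost disjoint inside 2S.\<close>

lemma emeasure_midpoint_set_ge:
  fixes A B S :: "real set"
  assumes [measurable]: "A \<in> sets borel" "B \<in> sets borel" "S \<in> sets borel"
    and "A \<noteq> {}" "B \<noteq> {}" "bdd_above A" "bdd_below B"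
    and mid: "\<And>x y. x \<in> A \<Longrightarrow> y \<in> B \<Longrightarrow> (x + y) / 2 \<in> S"
  shows "emeasure lborel A + emeasure lborel B \<le> 2 * emeasure lborel S"
proof (rule ennreal_le_epsilon)
  fix e :: real assume e: "0 < e"
  obtain a where a: "a \<in> A" "Sup A - e / 2 < a"
    using less_cSupE[of "Sup A - e / 2" A] assms(4) e by (metis diff_less_eq half_gt_zero less_add_same_cancel1)
  obtain b where b: "b \<in> B" "b < Inf B + e / 2"
    using cInf_lessD[of B "Inf B + e / 2"] assms(5) e by (metis half_gt_zero less_add_same_cancel1)
  let ?A = "A \<inter> {..<a}" and ?B = "B \<inter> {b..}"
  have "A \<subseteq> ?A \<union> {a .. a + e / 2}"
    using a cSup_upper[OF _ \<open>bdd_above A\<close>] by force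
  then have 1: "emeasure lborel A \<le> emeasure lborel ?A + ennreal (e / 2)"
    using emeasure_mono[of A "?A \<union> {a .. a + e / 2}" lborel]
      emeasure_subadditive[of ?A lborel "{a .. a + e / 2}"] e
    by (force intro: order_trans)
  have "B \<subseteq> ?B \<union> {b - e / 2 .. b}"
    using b cInf_lower[OF _ \<open>bdd_below B\<close>] by force
  then have 2: "emeasure lborel B \<le> emeasure lborel ?B + ennreal (e / 2)"
    using emeasure_mono[of B "?B \<union> {b - e / 2 .. b}" lborel]
      emeasure_subadditive[of ?B lborel "{b - e / 2 .. b}"] e
    by (force intro: order_trans)
  have half: "emeasure lborel ((\<lambda>x. (x + c) / 2) ` E) * 2 = emeasure lborel E"
    and half_meas: "(\<lambda>x. (x + c) / 2) ` E \<in> sets borel"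
    if [measurable]: "E \<in> sets borel" for E and c :: real
  proof -
    have img: "(\<lambda>x. (x + c) / 2) ` E = {x. - c + 2 * x \<in> E}"
      by (force simp: image_iff field_simps)
    have "{x \<in> space borel. - c + 2 * x \<in> E} \<in> sets borel"
      by measurable
    then show m: "(\<lambda>x. (x + c) / 2) ` E \<in> sets borel"
      by (simp add: img)
    have "emeasure lborel E = (\<integral>\<^sup>+x. indicator E x \<partial>lborel)"
      by simp
    also have "\<dots> = 2 * (\<integral>\<^sup>+x. indicator E (- c + 2 * x) \<partial>lborel)"
      by (subst nn_integral_real_affine[where c=2 and t="- c"]) auto
    also have "(\<lambda>x. indicator E (- c + 2 * x)) = (indicator ((\<lambda>x. (x + c) / 2) ` E) :: real \<Rightarrow> ennreal)"
      by (auto simp: img indicator_def)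
    finally show "emeasure lborel ((\<lambda>x. (x + c) / 2) ` E) * 2 = emeasure lborel E"
      using m by (simp add: mult.commute)
  qed
  let ?A' = "(\<lambda>x. (x + b) / 2) ` ?A" and ?B' = "(\<lambda>x. (x + a) / 2) ` ?B"
  have [measurable]: "?A' \<in> sets borel" "?B' \<in> sets borel"
    by (auto intro!: half_meas)
  have "?A' \<inter> ?B' = {}"
    by (auto simp: field_simps)
  moreover have "?A' \<union> ?B' \<subseteq> S"
    using mid[OF a(1)] mid[OF _ b(1)] by (auto simp: add.commute[of _ a])
  ultimately have "emeasure lborel ?A' + emeasure lborel ?B' \<le> emeasure lborel S"
    by (subst plus_emeasure) (auto intro!: emeasure_mono)
  then have "2 * (emeasure lborel ?A' + emeasure lborel ?B') \<le> 2 * emeasure lborel S"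
    by (rule mult_left_mono) simp
  also have "2 * (emeasure lborel ?A' + emeasure lborel ?B') = emeasure lborel ?A + emeasure lborel ?B"
    using half[of ?A b] half[of ?B a] by (simp add: algebra_simps)
  finally have 3: "emeasure lborel ?A + emeasure lborel ?B \<le> 2 * emeasure lborel S" .
  have "emeasure lborel A + emeasure lborel B
      \<le> (emeasure lborel ?A + ennreal (e / 2)) + (emeasure lborel ?B + ennreal (e / 2))"
    by (rule add_mono[OF 1 2])
  also have "\<dots> = (emeasure lborel ?A + emeasure lborel ?B) + ennreal e"
    using e by (simp add: ac_simps flip: ennreal_plus)
  also have "\<dots> \<le> 2 * emeasure lborel S + ennreal e"
    using 3 by (rule add_right_mono)
  finally show "emeasure lborel A + emeasure lborel B \<le> 2 * emeasure lborel S + ennreal e" .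
qed

lemma nn_integral_layer_cake:
  fixes f :: "real \<Rightarrow> ennreal"
  assumes [measurable]: "f \<in> borel_measurable borel"
  shows "(\<integral>\<^sup>+x. min 1 (f x) \<partial>lborel)
    = (\<integral>\<^sup>+l. indicator {0<..<1} l * emeasure lborel {x. ennreal l < f x} \<partial>lborel)"
proof -
  have one: "(\<integral>\<^sup>+l. indicator {0<..<1} l * indicator {x. ennreal l < f x} x \<partial>lborel) = min 1 (f x)" for x
  proof -
    have "(\<lambda>l. indicator {0<..<1} l * indicator {x. ennreal l < f x} x)
        = (indicator {0<..<enn2real (min 1 (f x))} :: real \<Rightarrow> ennreal)"
    proof (rule ext)
      fix l
      have "0 < l \<and> l < 1 \<and> ennreal l < f x \<longleftrightarrow> 0 < l \<and> l < enn2real (min 1 (f x))"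
      proof (cases "1 \<le> f x")
        case True
        then show ?thesis
          by (auto simp: min_def intro: less_le_trans[of _ 1])
      next
        case False
        then obtain r where "f x = ennreal r" "0 \<le> r" "r < 1"
          by (cases "f x") (auto simp: not_le simp flip: ennreal_1)
        then show ?thesis
          by (auto simp: min_def ennreal_less_iff)
      qed
      then show "indicator {0<..<1} l * indicator {x. ennreal l < f x} x
          = (indicator {0<..<enn2real (min 1 (f x))} l :: ennreal)"
        by (auto simp: indicator_def)
    qed
    then have "(\<integral>\<^sup>+l. indicator {0<..<1} l * indicator {x. ennreal l < f x} x \<partial>lborel)
        = emeasure lborel {0<..<enn2real (min 1 (f x))}"
      by simp
    also have "\<dots> = min 1 (f x)"
      by (subst emeasure_lborel_Ioo) (auto simp: min_def not_le intro!: ennreal_enn2real elim: less_trans)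
    finally show ?thesis .
  qed
  have "(\<integral>\<^sup>+x. min 1 (f x) \<partial>lborel)
      = (\<integral>\<^sup>+x. (\<integral>\<^sup>+l. indicator {0<..<1} l * indicator {x. ennreal l < f x} x \<partial>lborel) \<partial>lborel)"
    by (simp add: one)
  also have "\<dots> = (\<integral>\<^sup>+l. (\<integral>\<^sup>+x. indicator {0<..<1} l * indicator {x. ennreal l < f x} x \<partial>lborel) \<partial>lborel)"
    by (rule lborel_pair.Fubini') measurable
  also have "\<dots> = (\<integral>\<^sup>+l. indicator {0<..<1} l * emeasure lborel {x. ennreal l < f x} \<partial>lborel)"
    by (intro nn_integral_cong) (simp add: nn_integral_cmult)
  finally show ?thesis .
qed

text \<open>When f and g have supremum 1, the superlevel sets of f and g at each level l < 1 are
  nonempty and their midpoints lie in the superlevel set of h, so Brunn-Minkowski can be integrated over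
  l.\<close>

lemma prekopa_leindler_real_normalized:
  fixes f g h :: "real \<Rightarrow> ennreal"
  assumes [measurable]: "f \<in> borel_measurable borel" "g \<in> borel_measurable borel" "h \<in> borel_measurable borel"
    and supp: "\<And>x. x \<notin> {-R..R} \<Longrightarrow> f x = 0" "\<And>x. x \<notin> {-R..R} \<Longrightarrow> g x = 0"
    and sup: "(SUP x. f x) = 1" "(SUP x. g x) = 1"
    and le: "\<And>x y. f x * g y \<le> (h ((x + y) / 2))\<^sup>2"
  shows "(\<integral>\<^sup>+x. f x \<partial>lborel) + (\<integral>\<^sup>+x. g x \<partial>lborel) \<le> 2 * (\<integral>\<^sup>+x. h x \<partial>lborel)"
proof -
  have f1: "f x \<le> 1" and g1: "g x \<le> 1" for x
    using sup by (metis SUP_upper UNIV_I)+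
  let ?L = "\<lambda>f :: real \<Rightarrow> ennreal. \<lambda>l. indicator {0<..<1} l * emeasure lborel {x. ennreal l < f x}"
  have [measurable]: "?L f \<in> borel_measurable lborel" "?L g \<in> borel_measurable lborel" "?L h \<in>
      borel_measurable lborel"
    by measurable
  have lev: "?L f l + ?L g l \<le> 2 * ?L h l" for l
  proof (cases "0 < l \<and> l < 1")
    case True
    then have l1: "ennreal l < 1" by simp
    obtain x0 where x0: "ennreal l < f x0"
      using l1 sup(1) less_SUP_iff by metis
    obtain y0 where y0: "ennreal l < g y0"
      using l1 sup(2) less_SUP_iff by metis
    have in_R: "x \<in> {-R..R}" if "ennreal l < f x \<or> ennreal l < g x" for x
      using supp[of x] that by force
    have "emeasure lborel {x. ennreal l < f x} + emeasure lborel {x. ennreal l < g x}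
        \<le> 2 * emeasure lborel {x. ennreal l < h x}"
    proof (rule emeasure_midpoint_set_ge)
      show "bdd_above {x. ennreal l < f x}"
        using in_R by (auto intro!: bdd_aboveI[of _ R])
      show "bdd_below {x. ennreal l < g x}"
        using in_R by (auto intro!: bdd_belowI[of _ "-R"])
      fix x y assume "x \<in> {x. ennreal l < f x}" "y \<in> {x. ennreal l < g x}"
      then have "ennreal l * ennreal l < f x * g y"
        using ennreal_mult_strict_right_mono[of "ennreal l" "f x" "ennreal l"] True
        by (intro less_le_trans[OF _ mult_left_mono[of "ennreal l" "g y" "f x"]]) auto
      also have "\<dots> \<le> (h ((x + y) / 2))\<^sup>2" by (rule le)
      finally have "(ennreal l)\<^sup>2 < (h ((x + y) / 2))\<^sup>2" by (simp add: power2_eq_square)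
      then show "(x + y) / 2 \<in> {x. ennreal l < h x}"
        by (metis mem_Collect_eq not_le power_mono zero_le)
    qed (use x0 y0 in auto)
    then show ?thesis using True by simp
  qed auto
  have "(\<integral>\<^sup>+x. f x \<partial>lborel) + (\<integral>\<^sup>+x. g x \<partial>lborel)
      = (\<integral>\<^sup>+x. min 1 (f x) \<partial>lborel) + (\<integral>\<^sup>+x. min 1 (g x) \<partial>lborel)"
    using f1 g1 by (simp add: min_absorb2)
  also have "\<dots> = (\<integral>\<^sup>+l. ?L f l + ?L g l \<partial>lborel)"
    by (simp add: nn_integral_layer_cake nn_integral_add)
  also have "\<dots> \<le> (\<integral>\<^sup>+l. 2 * ?L h l \<partial>lborel)"
    by (intro nn_integral_mono lev)
  also have "\<dots> = 2 * (\<integral>\<^sup>+x. min 1 (h x) \<partial>lborel)"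
    by (simp add: nn_integral_cmult nn_integral_layer_cake)
  also have "\<dots> \<le> 2 * (\<integral>\<^sup>+x. h x \<partial>lborel)"
    by (intro mult_left_mono nn_integral_mono) auto
  finally show ?thesis .
qed

lemma ennreal_mult_le_square_mean:
  fixes X Y Z :: ennreal
  assumes "X + Y \<le> 2 * Z"
  shows "X * Y \<le> Z\<^sup>2"
proof (cases "Z = \<infinity>")
  case False
  then obtain z where z: "Z = ennreal z" "0 \<le> z"
    by (cases Z) auto
  have "2 * Z < \<infinity>"
    using z by (simp add: ennreal_mult_less_top)
  then have "X < \<infinity>" "Y < \<infinity>"
    using assms by (auto simp: less_top[symmetric] top_unique)
  then obtain x y where xy: "X = ennreal x" "0 \<le> x" "Y = ennreal y" "0 \<le> y"
    by (cases X; cases Y) auto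
  have "ennreal (x + y) \<le> ennreal (2 * z)"
    using assms xy z by (simp add: ennreal_mult)
  then have "x + y \<le> 2 * z"
    using z by (simp add: ennreal_le_iff)
  then have "(x + y)\<^sup>2 \<le> (2 * z)\<^sup>2"
    using xy by (intro power_mono) auto
  moreover have "4 * (x * y) \<le> (x + y)\<^sup>2"
    using zero_le_power2[of "x - y"] by (simp add: power2_eq_square algebra_simps)
  ultimately have "x * y \<le> z\<^sup>2"
    by (simp add: power2_eq_square)
  then show ?thesis
    using xy z by (simp add: ennreal_power flip: ennreal_mult)
qed (simp add: power2_eq_square ennreal_top_mult)

text \<open>Dividing f and g by their suprema reduces to the normalized case, whose arithmetic mean
  bound is stronger than the geometric mean bound wanted here.\<close>

lemma prekopa_leindler_real_bounded:
  fixes f g h :: "real \<Rightarrow> ennreal"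
  assumes [measurable]: "f \<in> borel_measurable borel" "g \<in> borel_measurable borel" "h \<in> borel_measurable borel"
    and supp: "\<And>x. x \<notin> {-R..R} \<Longrightarrow> f x = 0" "\<And>x. x \<notin> {-R..R} \<Longrightarrow> g x = 0"
    and bnd: "\<And>x. f x \<le> ennreal K" "\<And>x. g x \<le> ennreal K"
    and le: "\<And>x y. f x * g y \<le> (h ((x + y) / 2))\<^sup>2"
  shows "(\<integral>\<^sup>+x. f x \<partial>lborel) * (\<integral>\<^sup>+x. g x \<partial>lborel) \<le> (\<integral>\<^sup>+x. h x \<partial>lborel)\<^sup>2"
proof (cases "(SUP x. f x) = 0 \<or> (SUP x. g x) = 0")
  case True
  then have "(\<forall>x. f x = 0) \<or> (\<forall>x. g x = 0)"
    by (metis SUP_upper UNIV_I le_zero_eq)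
  then show ?thesis by auto
next
  case False
  have "(SUP x. f x) \<le> ennreal K" "(SUP x. g x) \<le> ennreal K"
    using bnd by (auto intro: SUP_least)
  then have "(SUP x. f x) < \<infinity>" "(SUP x. g x) < \<infinity>"
    by (auto intro: le_less_trans)
  with False obtain m n where mn: "(SUP x. f x) = ennreal m" "0 < m" "(SUP x. g x) = ennreal n" "0 < n"
    by (cases "SUP x. f x"; cases "SUP x. g x") (auto simp: less_le)
  define s where "s = sqrt (m * n)"
  have s: "0 < s" "s\<^sup>2 = m * n"
    using mn by (auto simp: s_def)
  have inv: "ennreal c * ennreal (1 / c) = 1" "ennreal (1 / c) * ennreal c = 1" if "0 < c" for c
    using that by (simp_all flip: ennreal_mult)
  have split: "ennreal (1 / (m * n)) = ennreal (1 / m) * ennreal (1 / n)"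
    using mn by (simp flip: ennreal_mult)
  have "(\<integral>\<^sup>+x. ennreal (1 / m) * f x \<partial>lborel) + (\<integral>\<^sup>+x. ennreal (1 / n) * g x \<partial>lborel)
      \<le> 2 * (\<integral>\<^sup>+x. ennreal (1 / s) * h x \<partial>lborel)"
  proof (rule prekopa_leindler_real_normalized[where R=R])
    show "(SUP x. ennreal (1 / m) * f x) = 1" "(SUP x. ennreal (1 / n) * g x) = 1"
      using mn inv by (simp_all add: SUP_mult_left_ennreal[symmetric])
    fix x y
    have "ennreal (1 / m) * f x * (ennreal (1 / n) * g y) = ennreal (1 / (m * n)) * (f x * g y)"
      by (simp only: split ac_simps)
    also have "\<dots> \<le> ennreal (1 / (m * n)) * (h ((x + y) / 2))\<^sup>2"
      by (intro mult_left_mono le) simp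
    also have "ennreal (1 / (m * n)) = (ennreal (1 / s))\<^sup>2"
      using s by (simp add: ennreal_power power_divide)
    also have "(ennreal (1 / s))\<^sup>2 * (h ((x + y) / 2))\<^sup>2 = (ennreal (1 / s) * h ((x + y) / 2))\<^sup>2"
      by (simp add: power_mult_distrib)
    finally show "ennreal (1 / m) * f x * (ennreal (1 / n) * g y) \<le> (ennreal (1 / s) * h ((x + y) / 2))\<^sup>2" .
  qed (use supp in auto)
  then have "ennreal (1 / m) * (\<integral>\<^sup>+x. f x \<partial>lborel) + ennreal (1 / n) * (\<integral>\<^sup>+x. g x \<partial>lborel)
      \<le> 2 * (ennreal (1 / s) * (\<integral>\<^sup>+x. h x \<partial>lborel))"
    by (simp add: nn_integral_cmult)
  from ennreal_mult_le_square_mean[OF this]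
  have "ennreal (1 / (m * n)) * ((\<integral>\<^sup>+x. f x \<partial>lborel) * (\<integral>\<^sup>+x. g x \<partial>lborel))
      \<le> (ennreal (1 / s))\<^sup>2 * (\<integral>\<^sup>+x. h x \<partial>lborel)\<^sup>2"
    by (simp only: split ac_simps power_mult_distrib)
  also have "(ennreal (1 / s))\<^sup>2 = ennreal (1 / (m * n))"
    using s by (simp add: ennreal_power power_divide)
  finally have "ennreal (m * n) * (ennreal (1 / (m * n)) * ((\<integral>\<^sup>+x. f x \<partial>lborel) * (\<integral>\<^sup>+x. g x \<partial>lborel)))
      \<le> ennreal (m * n) * (ennreal (1 / (m * n)) * (\<integral>\<^sup>+x. h x \<partial>lborel)\<^sup>2)"
    by (rule mult_left_mono) simp
  then show ?thesis
    using inv[of "m * n"] mn by (simp add: mult.assoc[symmetric])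
qed

lemma nn_integral_truncation:
  fixes f :: "real \<Rightarrow> ennreal"
  assumes [measurable]: "f \<in> borel_measurable borel"
  shows "(\<integral>\<^sup>+x. f x \<partial>lborel)
    = (SUP k. \<integral>\<^sup>+x. min (f x) (of_nat k) * indicator {- real k..real k} x \<partial>lborel)"
proof -
  let ?f = "\<lambda>k x. min (f x) (of_nat k) * indicator {- real k..real k} x"
  have "(SUP k. ?f k x) = f x" for x
  proof (rule antisym)
    show "(SUP k. ?f k x) \<le> f x"
      by (auto intro!: SUP_least simp: indicator_def)
    show "f x \<le> (SUP k. ?f k x)"
    proof (rule dense_le)
      fix y assume y: "y < f x"
      then have "y < \<infinity>"
        using less_top_ennreal less_trans
            by (metis infinity_ennreal_def not_less_iff_gr_or_eq top.not_eq_extremum)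
      then obtain n :: nat where n: "y < of_nat n"
        using ennreal_Ex_less_of_nat by (metis infinity_ennreal_def)
      define k where "k = max n (nat \<lceil>\<bar>x\<bar>\<rceil>)"
      have "\<bar>x\<bar> \<le> real k" "n \<le> k"
        unfolding k_def by linarith+
      then have "y \<le> ?f k x"
        using y n of_nat_mono[of n k, where 'a=ennreal]
            by (auto simp: indicator_def abs_le_iff intro: order.trans[OF less_imp_le])
      also have "\<dots> \<le> (SUP k. ?f k x)"
        by (rule SUP_upper) simp
      finally show "y \<le> (SUP k. ?f k x)" .
    qed
  qed
  then have "(\<integral>\<^sup>+x. f x \<partial>lborel) = (\<integral>\<^sup>+x. (SUP k. ?f k x) \<partial>lborel)"
    by simp
  also have "\<dots> = (SUP k. \<integral>\<^sup>+x. ?f k x \<partial>lborel)"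
  proof (rule nn_integral_monotone_convergence_SUP)
    show "incseq ?f"
    proof (intro incseq_SucI le_funI)
      fix k x
      have "min (f x) (of_nat k) \<le> min (f x) (of_nat (Suc k))"
        by (intro min.mono order_refl of_nat_mono) simp
      then show "?f k x \<le> ?f (Suc k) x"
        by (auto simp: indicator_def)
    qed
  qed simp
  finally show ?thesis .
qed

lemma prekopa_leindler_real:
  fixes f g h :: "real \<Rightarrow> ennreal"
  assumes [measurable]: "f \<in> borel_measurable borel" "g \<in> borel_measurable borel" "h \<in> borel_measurable borel"
    and le: "\<And>x y. f x * g y \<le> (h ((x + y) / 2))\<^sup>2"
  shows "(\<integral>\<^sup>+x. f x \<partial>lborel) * (\<integral>\<^sup>+x. g x \<partial>lborel) \<le> (\<integral>\<^sup>+x. h x \<partial>lborel)\<^sup>2"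
proof -
  let ?t = "\<lambda>f :: real \<Rightarrow> ennreal. \<lambda>k x. min (f x) (of_nat k) * indicator {- real k..real k} x"
  have mono: "?t f k x \<le> ?t f l x" if "k \<le> l" for f :: "real \<Rightarrow> ennreal" and k l x
  proof -
    have "min (f x) (of_nat k) \<le> min (f x) (of_nat l)"
      using that by (intro min.mono order_refl of_nat_mono)
    then show ?thesis using that by (auto simp: indicator_def)
  qed
  have "(\<integral>\<^sup>+x. ?t f j x \<partial>lborel) * (\<integral>\<^sup>+x. ?t g k x \<partial>lborel) \<le> (\<integral>\<^sup>+x. h x \<partial>lborel)\<^sup>2" for j k
  proof -
    define l where "l = max j k"
    have "(\<integral>\<^sup>+x. ?t f j x \<partial>lborel) * (\<integral>\<^sup>+x. ?t g k x \<partial>lborel)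
        \<le> (\<integral>\<^sup>+x. ?t f l x \<partial>lborel) * (\<integral>\<^sup>+x. ?t g l x \<partial>lborel)"
      unfolding l_def by (intro mult_mono nn_integral_mono mono) auto
    also have "\<dots> \<le> (\<integral>\<^sup>+x. h x \<partial>lborel)\<^sup>2"
    proof (rule prekopa_leindler_real_bounded[where R="real l" and K="real l"])
      fix x y
      have "?t f l x * ?t g l y \<le> f x * g y"
        by (intro mult_mono) (auto simp: indicator_def)
      also note le
      finally show "?t f l x * ?t g l y \<le> (h ((x + y) / 2))\<^sup>2" .
    qed (auto simp: indicator_def ennreal_of_nat_eq_real_of_nat)
    finally show ?thesis .
  qed
  then have "(SUP j. \<integral>\<^sup>+x. ?t f j x \<partial>lborel) * (SUP k. \<integral>\<^sup>+x. ?t g k x \<partial>lborel) \<le> (\<integral>\<^sup>+x. h x \<partial>lborel)\<^sup>2"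
    by (subst SUP_mult_right_ennreal, subst SUP_mult_left_ennreal) (intro SUP_least)
  then show ?thesis
    unfolding nn_integral_truncation[OF assms(1)] nn_integral_truncation[OF assms(2)] .
qed

text \<open>Induction on the number of coordinates: the integrals over all but one coordinate satisfy,
  as functions of the remaining one, the hypothesis of the one-dimensional inequality.\<close>

lemma prekopa_leindler_PiM:
  fixes f g h :: "('i \<Rightarrow> real) \<Rightarrow> ennreal"
  assumes "finite I"
    and "f \<in> borel_measurable (PiM I (\<lambda>_. lborel))"
      "g \<in> borel_measurable (PiM I (\<lambda>_. lborel))" "h \<in> borel_measurable (PiM I (\<lambda>_. lborel))"
    and "\<And>x y. x \<in> space (PiM I (\<lambda>_. lborel :: real measure)) \<Longrightarrow> y \<in> space (PiM I (\<lambda>_. lborel :: real measure))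
      \<Longrightarrow> f x * g y \<le> (h (\<lambda>i\<in>I. (x i + y i) / 2))\<^sup>2"
  shows "(\<integral>\<^sup>+x. f x \<partial>PiM I (\<lambda>_. lborel)) * (\<integral>\<^sup>+x. g x \<partial>PiM I (\<lambda>_. lborel)) \<le> (\<integral>\<^sup>+x. h x \<partial>PiM I (\<lambda>_. lborel))\<^sup>2"
  using assms
proof (induction I arbitrary: f g h rule: finite_induct)
  case empty
  interpret product_sigma_finite "\<lambda>_ :: 'i. lborel :: real measure" ..
  show ?case
    using empty.prems(4)[of "\<lambda>_. undefined" "\<lambda>_. undefined"]
    by (simp add: nn_integral_empty space_PiM restrict_def)
next
  case (insert i I)
  interpret product_sigma_finite "\<lambda>_ :: 'i. lborel :: real measure" ..
  note [measurable] = insert.prems(1-3)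
  have [measurable]: "(\<lambda>(x, t). x(i := t)) \<in> PiM I (\<lambda>_. lborel) \<Otimes>\<^sub>M lborel \<rightarrow>\<^sub>M PiM (insert i I)
      (\<lambda>_. lborel :: real measure)"
    by (rule measurable_add_dim)
  have [measurable]: "(\<lambda>x. x(i := t)) \<in> PiM I (\<lambda>_. lborel) \<rightarrow>\<^sub>M PiM (insert i I)
      (\<lambda>_. lborel :: real measure)" for t :: real
    using measurable_compose[OF _ \<open>(\<lambda>(x, t). x(i := t)) \<in> _\<close>, of "\<lambda>x. (x, t)" "PiM I (\<lambda>_. lborel)"] by simp
  have sec: "(\<lambda>x. k (x(i := t))) \<in> borel_measurable (PiM I (\<lambda>_. lborel))"
    and int: "(\<lambda>t. \<integral>\<^sup>+x. k (x(i := t)) \<partial>PiM I (\<lambda>_. lborel)) \<in> borel_measurable borel"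
    if [measurable]: "k \<in> borel_measurable (PiM (insert i I) (\<lambda>_. lborel))" for k :: "('i \<Rightarrow> real) \<Rightarrow> ennreal"
        and t
  proof -
    interpret J: finite_product_sigma_finite "\<lambda>_ :: 'i. lborel :: real measure" I
      by standard (rule insert.hyps)
    show "(\<lambda>x. k (x(i := t))) \<in> borel_measurable (PiM I (\<lambda>_. lborel))"
      by measurable
    have "(\<lambda>(t, x). k (x(i := t))) = (\<lambda>(x, t). k (x(i := t))) \<circ> (\<lambda>(t, x). (x, t))"
      by auto
    moreover have "(\<lambda>(x, t). k (x(i := t))) \<in> borel_measurable (PiM I (\<lambda>_. lborel) \<Otimes>\<^sub>M lborel)"
      using measurable_compose[OF \<open>(\<lambda>(x, t). x(i := t)) \<in> _\<close> that] by (simp add: case_prod_unfold)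
    ultimately have "(\<lambda>(t, x). k (x(i := t))) \<in> borel_measurable (lborel \<Otimes>\<^sub>M PiM I (\<lambda>_. lborel))"
      by (metis measurable_comp measurable_pair_swap')
    then show "(\<lambda>t. \<integral>\<^sup>+x. k (x(i := t)) \<partial>PiM I (\<lambda>_. lborel)) \<in> borel_measurable borel"
      using J.borel_measurable_nn_integral[of "\<lambda>t x. k (x(i := t))" lborel] by simp
  qed
  have "(\<integral>\<^sup>+t. \<integral>\<^sup>+x. f (x(i := t)) \<partial>PiM I (\<lambda>_. lborel) \<partial>lborel)
      * (\<integral>\<^sup>+t. \<integral>\<^sup>+x. g (x(i := t)) \<partial>PiM I (\<lambda>_. lborel) \<partial>lborel)
      \<le> (\<integral>\<^sup>+t. \<integral>\<^sup>+x. h (x(i := t)) \<partial>PiM I (\<lambda>_. lborel) \<partial>lborel)\<^sup>2"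
  proof (rule prekopa_leindler_real)
    fix s t :: real
    show "(\<integral>\<^sup>+x. f (x(i := s)) \<partial>PiM I (\<lambda>_. lborel)) * (\<integral>\<^sup>+x. g (x(i := t)) \<partial>PiM I (\<lambda>_. lborel))
      \<le> (\<integral>\<^sup>+x. h (x(i := (s + t) / 2)) \<partial>PiM I (\<lambda>_. lborel))\<^sup>2"
    proof (rule insert.IH)
      fix x y :: "'i \<Rightarrow> real"
      assume xy: "x \<in> space (PiM I (\<lambda>_. lborel :: real measure))" "y \<in> space (PiM I
          (\<lambda>_. lborel :: real measure))"
      have "(\<lambda>j\<in>I. (x j + y j) / 2)(i := (s + t) / 2) = (\<lambda>j\<in>insert i I. ((x(i := s)) j + (y(i := t)) j) / 2)"
        using insert.hyps by (auto simp: fun_eq_iff)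
      moreover have "x(i := s) \<in> space (PiM (insert i I) (\<lambda>_. lborel :: real measure))"
        "y(i := t) \<in> space (PiM (insert i I) (\<lambda>_. lborel :: real measure))"
        using xy by (auto simp: space_PiM PiE_fun_upd)
      ultimately show "f (x(i := s)) * g (y(i := t)) \<le> (h ((\<lambda>j\<in>I. (x j + y j) / 2)(i := (s + t) / 2)))\<^sup>2"
        using insert.prems(4) by metis
    qed (intro sec insert.prems)+
  qed (intro int insert.prems)+
  then show ?case
    unfolding product_nn_integral_insert_rev[OF insert.hyps insert.prems(1)]
      product_nn_integral_insert_rev[OF insert.hyps insert.prems(2)]
      product_nn_integral_insert_rev[OF insert.hyps insert.prems(3)] .
qed

text \<open>The Prekopa-Leindler inequality at the midpoint. The square on the right replaces the square
  root of the product on the left, which keeps the statement inside the extended nonnegative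
  reals.\<close>

theorem prekopa_leindler:
  fixes f g h :: "'a::euclidean_space \<Rightarrow> ennreal"
  assumes [measurable]: "f \<in> borel_measurable borel" "g \<in> borel_measurable borel" "h \<in> borel_measurable borel"
    and le: "\<And>x y. f x * g y \<le> (h ((1 / 2) *\<^sub>R (x + y)))\<^sup>2"
  shows "(\<integral>\<^sup>+x. f x \<partial>lborel) * (\<integral>\<^sup>+x. g x \<partial>lborel) \<le> (\<integral>\<^sup>+x. h x \<partial>lborel)\<^sup>2"
proof -
  let ?P = "PiM (Basis :: 'a set) (\<lambda>_. lborel :: real measure)"
  let ?V = "\<lambda>c. (\<Sum>b\<in>Basis. c b *\<^sub>R b) :: 'a"
  have [measurable]: "?V \<in> ?P \<rightarrow>\<^sub>M borel"
    by measurable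
  have "(\<integral>\<^sup>+x. f (?V x) \<partial>?P) * (\<integral>\<^sup>+x. g (?V x) \<partial>?P) \<le> (\<integral>\<^sup>+x. h (?V x) \<partial>?P)\<^sup>2"
  proof (rule prekopa_leindler_PiM)
    fix x y
    have "?V (\<lambda>b\<in>Basis. (x b + y b) / 2) = (1 / 2) *\<^sub>R (?V x + ?V y)"
      by (simp add: scaleR_sum_right sum.distrib[symmetric] scaleR_add_left[symmetric] add_divide_distrib)
    then show "f (?V x) * g (?V y) \<le> (h (?V (\<lambda>b\<in>Basis. (x b + y b) / 2)))\<^sup>2"
      using le by simp
  qed measurable
  moreover have "(\<integral>\<^sup>+x. k x \<partial>lborel) = (\<integral>\<^sup>+x. k (?V x) \<partial>?P)"
    if [measurable]: "k \<in> borel_measurable borel" for k :: "'a \<Rightarrow> ennreal"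
    by (subst lborel_eq) (rule nn_integral_distr; measurable)
  ultimately show ?thesis
    by simp
qed

section \<open>Gaussian measure along lines\<close>

abbreviation std_gauss :: "real measure" where
  "std_gauss \<equiv> density lborel (\<lambda>s. ennreal (std_normal_density s))"

interpretation std_gauss: prob_space std_gauss
  by (rule prob_space_normal_density) simp

lemma gauss_density_prod:
  fixes x :: "real ^ 'n"
  shows "(2 * pi) powr (- real CARD('n) / 2) * exp (- ((norm x)\<^sup>2) / 2)
    = (\<Prod>b\<in>Basis. std_normal_density (x \<bullet> b))"
proof -
  have "(norm x)\<^sup>2 = (\<Sum>b\<in>Basis. (x \<bullet> b)\<^sup>2)"
    unfolding power2_norm_eq_inner by (subst euclidean_inner) (simp add: power2_eq_square)
  then have "exp (- ((norm x)\<^sup>2) / 2) = (\<Prod>b\<in>Basis. exp (- (x \<bullet> b)\<^sup>2 / 2))"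
    by (simp add: exp_sum[symmetric] sum_divide_distrib sum_negf)
  moreover have "(2 * pi) powr (- real CARD('n) / 2) = (\<Prod>b\<in>(Basis :: (real ^ 'n) set). 1 / sqrt (2 * pi))"
  proof -
    have "(2 * pi) powr (- real CARD('n) / 2) = ((2 * pi) powr (- (1 / 2))) powr real CARD('n)"
      by (simp add: powr_powr)
    also have "(2 * pi) powr (- (1 / 2)) = 1 / sqrt (2 * pi)"
      by (simp add: powr_minus_divide powr_half_sqrt)
    finally show ?thesis
      by (simp add: powr_realpow)
  qed
  ultimately show ?thesis
    unfolding std_normal_density_def prod.distrib by simp
qed

definition gauss_dens :: "real ^ 'n \<Rightarrow> real" where
  "gauss_dens x = (2 * pi) powr (- real CARD('n) / 2) * exp (- ((norm x)\<^sup>2) / 2)"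

lemma gauss_dens_pos: "0 < gauss_dens x"
  by (simp add: gauss_dens_def)

lemma gauss_dens_measurable [measurable]: "gauss_dens \<in> borel_measurable borel"
  unfolding gauss_dens_def by measurable

lemma gauss_measure_eq: "gauss_measure = density lborel (\<lambda>x. ennreal (gauss_dens x))"
  by (simp add: gauss_measure_def gauss_dens_def)

lemma space_gauss [simp]: "space gauss_measure = UNIV"
  by (simp add: gauss_measure_def)

lemma sets_gauss [simp, measurable_cong]: "sets gauss_measure = sets borel"
  by (simp add: gauss_measure_def)

interpretation gauss: prob_space "gauss_measure :: (real ^ 'n) measure"
proof
  have "emeasure gauss_measure (space gauss_measure :: (real ^ 'n) set)
      = (\<integral>\<^sup>+x. (\<Prod>b\<in>Basis. ennreal (std_normal_density (x \<bullet> b))) \<partial>(lborel :: (real ^ 'n) measure))"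
    unfolding gauss_measure_def gauss_density_prod by (simp add: emeasure_density prod_ennreal)
  also have "\<dots> = (\<Prod>b\<in>(Basis :: (real ^ 'n) set). \<integral>\<^sup>+s. ennreal (std_normal_density s) \<partial>lborel)"
    by (rule nn_integral_lborel_prod) auto
  also have "(\<integral>\<^sup>+s. ennreal (std_normal_density s) \<partial>lborel) = 1"
    by (simp add: nn_integral_eq_integral)
  finally show "emeasure gauss_measure (space gauss_measure :: (real ^ 'n) set) = 1"
    by simp
qed

lemma nn_integral_gauss:
  "f \<in> borel_measurable borel \<Longrightarrow> (\<integral>\<^sup>+x. f x \<partial>gauss_measure) = (\<integral>\<^sup>+x. ennreal (gauss_dens x) * f x \<partial>lborel)"
  by (simp add: gauss_measure_eq nn_integral_density)

lemma nn_integral_lborel_shift: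
  fixes f :: "'a::euclidean_space \<Rightarrow> ennreal"
  assumes [measurable]: "f \<in> borel_measurable borel"
  shows "(\<integral>\<^sup>+x. f (c + x) \<partial>lborel) = (\<integral>\<^sup>+x. f x \<partial>lborel)"
proof -
  have "(\<integral>\<^sup>+x. f x \<partial>lborel) = (\<integral>\<^sup>+x. f x \<partial>distr lborel borel ((+) c))"
    by (simp only: lborel_distr_plus)
  also have "\<dots> = (\<integral>\<^sup>+x. f (c + x) \<partial>lborel)"
    by (rule nn_integral_distr) measurable
  finally show ?thesis by simp
qed

text \<open>Resampling the component of a Gaussian vector along a unit vector a from an independent
  standard normal variable does not change its law. Translating s by a \<bullet> x, and then x by s a,
  exchanges the roles of s and a \<bullet> x, so translation invariance of Lebesgue measure is
  enough.\<close>

lemma gauss_fibre_nn: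
  fixes a :: "real ^ 'n" and f :: "real ^ 'n \<Rightarrow> ennreal"
  assumes a: "norm a = 1" and [measurable]: "f \<in> borel_measurable borel"
  shows "(\<integral>\<^sup>+x. (\<integral>\<^sup>+s. f (x + (s - a \<bullet> x) *\<^sub>R a) \<partial>std_gauss) \<partial>gauss_measure) = (\<integral>\<^sup>+x. f x \<partial>gauss_measure)"
proof -
  let ?n = "\<lambda>s. ennreal (std_normal_density s)" and ?g = "\<lambda>x. ennreal (gauss_dens x)"
  have aa: "a \<bullet> a = 1"
    using a by (simp add: norm_eq_1)
  have dens: "gauss_dens (x - s *\<^sub>R a) * std_normal_density (a \<bullet> x)
      = gauss_dens x * std_normal_density (s - a \<bullet> x)" for x s
  proof -
    have "- (norm (x - s *\<^sub>R a))\<^sup>2 / 2 - (a \<bullet> x)\<^sup>2 / 2 = - (norm x)\<^sup>2 / 2 - (s - a \<bullet> x)\<^sup>2 / 2"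
      unfolding power2_norm_eq_inner
      by (simp add: inner_simps aa power2_eq_square inner_commute[of x a] field_simps)
    then have "exp (- (norm (x - s *\<^sub>R a))\<^sup>2 / 2) * exp (- (a \<bullet> x)\<^sup>2 / 2)
        = exp (- (norm x)\<^sup>2 / 2) * exp (- (s - a \<bullet> x)\<^sup>2 / 2)"
      by (simp flip: exp_add)
    then show ?thesis
      by (simp add: gauss_dens_def std_normal_density_def)
  qed
  have "(\<integral>\<^sup>+x. (\<integral>\<^sup>+s. f (x + (s - a \<bullet> x) *\<^sub>R a) \<partial>std_gauss) \<partial>gauss_measure)
      = (\<integral>\<^sup>+x. (\<integral>\<^sup>+s. ?g x * ?n s * f (x + (s - a \<bullet> x) *\<^sub>R a) \<partial>lborel) \<partial>lborel)"
    by (simp add: nn_integral_gauss nn_integral_density nn_integral_cmult[symmetric] mult.assoc)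
  also have "\<dots> = (\<integral>\<^sup>+x. (\<integral>\<^sup>+s. ?g x * ?n (a \<bullet> x + s) * f (x + s *\<^sub>R a) \<partial>lborel) \<partial>lborel)"
  proof (rule nn_integral_cong)
    fix x :: "real ^ 'n"
    show "(\<integral>\<^sup>+s. ?g x * ?n s * f (x + (s - a \<bullet> x) *\<^sub>R a) \<partial>lborel)
        = (\<integral>\<^sup>+s. ?g x * ?n (a \<bullet> x + s) * f (x + s *\<^sub>R a) \<partial>lborel)"
      using nn_integral_lborel_shift[of "\<lambda>s. ?g x * ?n s * f (x + (s - a \<bullet> x) *\<^sub>R a)" "a \<bullet> x"] by simp
  qed
  also have "\<dots> = (\<integral>\<^sup>+s. (\<integral>\<^sup>+x. ?g x * ?n (a \<bullet> x + s) * f (x + s *\<^sub>R a) \<partial>lborel) \<partial>lborel)"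
    by (rule lborel_pair.Fubini') measurable
  also have "\<dots> = (\<integral>\<^sup>+s. (\<integral>\<^sup>+x. ?g x * f x * ?n (s - a \<bullet> x) \<partial>lborel) \<partial>lborel)"
  proof (rule nn_integral_cong)
    fix s :: real
    have "(\<integral>\<^sup>+x. ?g x * ?n (a \<bullet> x + s) * f (x + s *\<^sub>R a) \<partial>lborel)
        = (\<integral>\<^sup>+x. ?g (x - s *\<^sub>R a) * ?n (a \<bullet> x) * f x \<partial>lborel)"
      using nn_integral_lborel_shift[of "\<lambda>x. ?g x * ?n (a \<bullet> x + s) * f (x + s *\<^sub>R a)" "- s *\<^sub>R a"]
      by (simp add: inner_simps aa add.commute[of "- _"])
    also have "\<dots> = (\<integral>\<^sup>+x. ?g x * f x * ?n (s - a \<bullet> x) \<partial>lborel)"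
    proof (rule nn_integral_cong)
      fix x
      have "?g (x - s *\<^sub>R a) * ?n (a \<bullet> x) = ?g x * ?n (s - a \<bullet> x)"
        using dens[of x s] by (simp add: gauss_dens_pos less_imp_le flip: ennreal_mult)
      then show "?g (x - s *\<^sub>R a) * ?n (a \<bullet> x) * f x = ?g x * f x * ?n (s - a \<bullet> x)"
        by (simp only: ac_simps)
    qed
    finally show "(\<integral>\<^sup>+x. ?g x * ?n (a \<bullet> x + s) * f (x + s *\<^sub>R a) \<partial>lborel)
        = (\<integral>\<^sup>+x. ?g x * f x * ?n (s - a \<bullet> x) \<partial>lborel)" .
  qed
  also have "\<dots> = (\<integral>\<^sup>+x. (\<integral>\<^sup>+s. ?g x * f x * ?n (s - a \<bullet> x) \<partial>lborel) \<partial>lborel)"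
    by (rule lborel_pair.Fubini') measurable
  also have "\<dots> = (\<integral>\<^sup>+x. ?g x * f x * (\<integral>\<^sup>+s. ?n s \<partial>lborel) \<partial>lborel)"
    using nn_integral_lborel_shift[of ?n "- (a \<bullet> x)" for x]
    by (simp add: nn_integral_cmult add.commute[of "- _"])
  also have "\<dots> = (\<integral>\<^sup>+x. ?g x * f x \<partial>lborel)"
    by (simp add: nn_integral_eq_integral)
  finally show ?thesis
    by (simp add: nn_integral_gauss)
qed

lemma gauss_fibre_distr:
  fixes a :: "real ^ 'n"
  assumes a: "norm a = 1"
  shows "distr (gauss_measure \<Otimes>\<^sub>M std_gauss) borel (\<lambda>(x, s). x + (s - a \<bullet> x) *\<^sub>R a) = gauss_measure"
proof (rule measure_eqI)
  fix A :: "(real ^ 'n) set"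
  assume "A \<in> sets (distr (gauss_measure \<Otimes>\<^sub>M std_gauss) borel (\<lambda>(x, s). x + (s - a \<bullet> x) *\<^sub>R a))"
  then have [measurable]: "A \<in> sets borel" by simp
  have "emeasure (distr (gauss_measure \<Otimes>\<^sub>M std_gauss) borel (\<lambda>(x, s). x + (s - a \<bullet> x) *\<^sub>R a)) A
      = (\<integral>\<^sup>+p. indicator A ((\<lambda>(x, s). x + (s - a \<bullet> x) *\<^sub>R a) p) \<partial>(gauss_measure \<Otimes>\<^sub>M std_gauss))"
    by (subst nn_integral_indicator[symmetric], simp, subst nn_integral_distr) simp_all
  also have "\<dots> = (\<integral>\<^sup>+x. (\<integral>\<^sup>+s. indicator A (x + (s - a \<bullet> x) *\<^sub>R a) \<partial>std_gauss) \<partial>gauss_measure)"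
    by (subst std_gauss.nn_integral_fst[symmetric]) simp_all
  also have "\<dots> = emeasure gauss_measure A"
    using gauss_fibre_nn[OF a, of "indicator A"] by simp
  finally show "emeasure (distr (gauss_measure \<Otimes>\<^sub>M std_gauss) borel (\<lambda>(x, s). x + (s - a \<bullet> x) *\<^sub>R a)) A
      = emeasure gauss_measure A" .
qed simp

lemma gauss_fibre_integral:
  fixes a :: "real ^ 'n" and f :: "real ^ 'n \<Rightarrow> real"
  assumes a: "norm a = 1" and f: "integrable gauss_measure f"
  shows "integrable gauss_measure (\<lambda>x. \<integral>s. f (x + (s - a \<bullet> x) *\<^sub>R a) \<partial>std_gauss)"
    and "(\<integral>x. f x \<partial>gauss_measure) = (\<integral>x. (\<integral>s. f (x + (s - a \<bullet> x) *\<^sub>R a) \<partial>std_gauss) \<partial>gauss_measure)"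
proof -
  interpret pair_prob_space "gauss_measure :: (real ^ 'n) measure" std_gauss ..
  have [measurable]: "f \<in> borel_measurable borel"
    using f borel_measurable_integrable by fastforce
  have i: "integrable (gauss_measure \<Otimes>\<^sub>M std_gauss) (\<lambda>p. f ((\<lambda>(x, s). x + (s - a \<bullet> x) *\<^sub>R a) p))"
    using f by (subst (asm) gauss_fibre_distr[OF a, symmetric]) (simp add: integrable_distr_eq)
  show "integrable gauss_measure (\<lambda>x. \<integral>s. f (x + (s - a \<bullet> x) *\<^sub>R a) \<partial>std_gauss)"
    using integrable_fst'[OF i] by simp
  have "(\<integral>x. f x \<partial>gauss_measure) = (\<integral>p. f ((\<lambda>(x, s). x + (s - a \<bullet> x) *\<^sub>R a) p) \<partial>(gauss_measure \<Otimes>\<^sub>M std_gauss))"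
    by (subst gauss_fibre_distr[OF a, symmetric]) (simp add: integral_distr)
  then show "(\<integral>x. f x \<partial>gauss_measure) = (\<integral>x. (\<integral>s. f (x + (s - a \<bullet> x) *\<^sub>R a) \<partial>std_gauss) \<partial>gauss_measure)"
    using integral_fst'[OF i] by simp
qed

lemma integrable_std_gauss_id: "integrable std_gauss (\<lambda>s. s)"
  using integrable_std_normal_moment[of 1] by (simp add: integrable_real_density)

lemma integrable_gauss_inner: "integrable gauss_measure (\<lambda>x :: real ^ 'n. y \<bullet> x)"
proof (cases "y = 0")
  case False
  define a where "a = (1 / norm y) *\<^sub>R y"
  have a: "norm a = 1" "a \<bullet> a = 1"
    using False by (simp_all add: a_def power2_norm_eq_inner[symmetric] power2_eq_square)
  have "(\<integral>\<^sup>+x. ennreal (norm (a \<bullet> x)) \<partial>gauss_measure)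
      = (\<integral>\<^sup>+x. (\<integral>\<^sup>+s. ennreal \<bar>s\<bar> \<partial>std_gauss) \<partial>(gauss_measure :: (real ^ 'n) measure))"
    by (subst gauss_fibre_nn[OF a(1), symmetric]) (simp_all add: inner_simps a)
  also have "\<dots> = (\<integral>\<^sup>+s. ennreal \<bar>s\<bar> \<partial>std_gauss)"
    by (simp add: gauss.emeasure_space_1[simplified])
  also have "\<dots> < \<infinity>"
    using integrable_std_gauss_id by (simp add: integrable_iff_bounded)
  finally have "integrable gauss_measure (\<lambda>x. a \<bullet> x)"
    by (simp add: integrable_iff_bounded)
  then have "integrable gauss_measure (\<lambda>x. norm y * (a \<bullet> x))"
    by simp
  then show ?thesis
    using False by (simp add: a_def)
qed simp

lemma null_gauss_iff:
  assumes "A \<in> sets borel"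
  shows "emeasure gauss_measure A = 0 \<longleftrightarrow> emeasure lborel A = 0"
proof -
  have "emeasure gauss_measure A = 0 \<longleftrightarrow> A \<in> null_sets gauss_measure"
    using assms by (auto simp: null_sets_def)
  also have "\<dots> \<longleftrightarrow> (AE x in lborel. x \<in> A \<longrightarrow> gauss_dens x \<le> 0)"
    using assms by (simp add: gauss_measure_eq null_sets_density_iff ennreal_eq_0_iff)
  also have "\<dots> \<longleftrightarrow> (AE x in lborel. x \<notin> A)"
    by (intro AE_cong) (simp add: gauss_dens_pos[THEN not_le[THEN iffD2]])
  also have "\<dots> \<longleftrightarrow> emeasure lborel A = 0"
    using assms by (simp add: AE_iff_measurable[of A])
  finally show ?thesis .
qed

lemma gauss_open_pos:
  assumes "open U" "U \<noteq> {}"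
  shows "0 < measure gauss_measure U"
proof -
  have "\<not> negligible U"
    using open_not_negligible assms by blast
  then have "emeasure lborel U \<noteq> 0"
    using assms by (simp add: negligible_iff_null_sets null_sets_def)
  then show ?thesis
    using null_gauss_iff[of U] assms by (simp add: gauss.emeasure_eq_measure zero_less_measure_iff)
qed

lemma gauss_hyperplane_null:
  fixes y :: "real ^ 'n"
  assumes "y \<noteq> 0"
  shows "measure gauss_measure {x. y \<bullet> x = 0} = 0"
proof -
  have "negligible {x. y \<bullet> x = 0}"
    using assms by (intro negligible_hyperplane) simp
  then have "emeasure lborel {x. y \<bullet> x = 0} = 0"
    by (simp add: negligible_iff_null_sets null_sets_def)
  then show ?thesis
    using null_gauss_iff[of "{x. y \<bullet> x = 0}"] by (simp add: measure_def)
qed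

section \<open>The tail of the normal distribution\<close>

definition gauss_tail :: "real \<Rightarrow> real" where
  "gauss_tail u = measure std_gauss {u..}"

lemma std_normal_density_has_derivative:
  "(std_normal_density has_real_derivative - u * std_normal_density u) (at u)"
  unfolding std_normal_density_def
  by (auto intro!: derivative_eq_intros simp: field_simps)

lemma std_normal_density_le: "std_normal_density u \<le> 1 / sqrt (2 * pi)"
  by (simp add: std_normal_density_def divide_right_mono)

lemma std_normal_density_minus [simp]: "std_normal_density (- u) = std_normal_density u"
  by (simp add: std_normal_density_def)

lemma gauss_tail_0 [simp]: "gauss_tail 0 = 1 / 2"
proof -
  have "emeasure std_gauss {..<0} = (\<integral>\<^sup>+s. ennreal (std_normal_density s) * indicator {..<0} s \<partial>lborel)"
    by (simp add: emeasure_density)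
  also have "\<dots> = (\<integral>\<^sup>+s. ennreal (std_normal_density s) * indicator {0<..} s \<partial>lborel)"
    by (subst nn_integral_real_affine[where c = "-1" and t = 0])
      (auto simp: indicator_def intro!: nn_integral_cong)
  also have "\<dots> = emeasure std_gauss {0<..}"
    by (simp add: emeasure_density)
  also have "\<dots> = emeasure std_gauss {0..}"
    by (intro emeasure_eq_AE) (auto simp: AE_density intro: AE_I2 eventually_mono[OF AE_lborel_singleton[of 0]])
  finally have "measure std_gauss {..<0} = gauss_tail 0"
    by (simp add: gauss_tail_def measure_def)
  moreover have "measure std_gauss {..<0} = 1 - gauss_tail 0"
    using std_gauss.prob_compl[of "{0..}"] by (simp add: gauss_tail_def Compl_eq_Diff_UNIV[symmetric])
  ultimately show ?thesis by simp
qed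

lemma gauss_tail_diff:
  assumes "u \<le> v"
  shows "gauss_tail u - gauss_tail v = integral {u..v} std_normal_density"
proof -
  have "{u..} = {u..<v} \<union> {v..}" using assms by auto
  then have "gauss_tail u = measure std_gauss {u..<v} + gauss_tail v"
    unfolding gauss_tail_def by (metis (no_types, lifting) std_gauss.finite_measure_Union
        ivl_disj_int_two(3) sets_density sets_lborel atLeastLessThan_borel atLeast_borel inf_commute
        Int_emptyI atLeastLessThan_iff atLeast_iff not_le)
  moreover have "measure std_gauss {u..<v} = measure std_gauss {u..v}"
    unfolding measure_def
    by (intro arg_cong[where f = enn2real] emeasure_eq_AE)
       (auto simp: AE_density intro: eventually_mono[OF AE_lborel_singleton[of v]])
  moreover have "measure std_gauss {u..v} = (LINT s:{u..v}|lborel. std_normal_density s)"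
    unfolding measure_def set_lebesgue_integral_def
    by (subst emeasure_density, simp, simp, subst integral_eq_nn_integral)
       (auto intro!: arg_cong[where f = enn2real] nn_integral_cong simp: indicator_def)
  moreover have "\<dots> = integral {u..v} std_normal_density"
    by (intro set_borel_integral_eq_integral(2))
       (auto simp: set_integrable_def intro!: integrable_mult_indicator integrable_normal_density simp del:
           real_scaleR_def)
  ultimately show ?thesis by simp
qed

lemma gauss_tail_has_derivative:
  "(gauss_tail has_real_derivative - std_normal_density u) (at u)"
proof -
  have "((\<lambda>x. integral {u
      - 1..x} std_normal_density) has_vector_derivative std_normal_density u) (at u within {u - 1..u + 1})"
    by (intro integral_has_vector_derivative)
      (auto simp: std_normal_density_def intro!: continuous_intros)
  then have "((\<lambda>x. integral {u
      - 1..x} std_normal_density) has_real_derivative std_normal_density u) (at u within {u - 1<..<u + 1})"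
    unfolding has_real_derivative_iff_has_vector_derivative
    by (rule has_vector_derivative_within_subset) auto
  then have "((\<lambda>x. integral {u - 1..x} std_normal_density) has_real_derivative std_normal_density u) (at u)"
    by (subst (asm) at_within_open) auto
  then have "((\<lambda>x. gauss_tail (u - 1) - integral {u - 1..x} std_normal_density) has_real_derivative
      - std_normal_density u) (at u)"
    by (auto intro!: derivative_eq_intros)
  then show ?thesis
  proof (rule DERIV_cong_ev[THEN iffD1, OF refl _ refl, rotated])
    have "eventually (\<lambda>x. x \<in> {u - 1<..}) (nhds u)"
      by (intro eventually_nhds_in_open) auto
    then show "\<forall>\<^sub>F x in nhds u. gauss_tail (u - 1) - integral {u - 1..x} std_normal_density = gauss_tail x"
      by eventually_elim (simp add: gauss_tail_diff[symmetric])
  qed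
qed

text \<open>For s \<ge> 0 and u \<ge> 0 the density at u + s is at most exp (- u^2 / 2) times the
  density at s.\<close>

lemma gauss_tail_le:
  assumes "0 \<le> u"
  shows "gauss_tail u \<le> exp (- u\<^sup>2 / 2) / 2"
proof -
  have *: "emeasure std_gauss {v..} = (\<integral>\<^sup>+s. ennreal (std_normal_density s) * indicator {v..} s \<partial>lborel)" for v
    by (simp add: emeasure_density)
  have "emeasure std_gauss {u..}
      = (\<integral>\<^sup>+s. ennreal (std_normal_density (u + s)) * indicator {u..} (u + s) \<partial>lborel)"
    unfolding * by (subst nn_integral_real_affine[where c = 1 and t = u]) auto
  also have "\<dots> \<le> (\<integral>\<^sup>+s. ennreal (exp (- u\<^sup>2 / 2)) * (ennreal
      (std_normal_density s) * indicator {0..} s) \<partial>lborel)"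
  proof (intro nn_integral_mono)
    fix s :: real
    show "ennreal (std_normal_density (u + s)) * indicator {u..} (u + s)
        \<le> ennreal (exp (- u\<^sup>2 / 2)) * (ennreal (std_normal_density s) * indicator {0..} s)"
    proof (cases "0 \<le> s")
      case True
      have "- (u + s)\<^sup>2 / 2 \<le> - u\<^sup>2 / 2 + - s\<^sup>2 / 2"
        using mult_nonneg_nonneg[OF assms True] by (simp add: power2_eq_square field_simps)
      then have "exp (- (u + s)\<^sup>2 / 2) \<le> exp (- u\<^sup>2 / 2) * exp (- s\<^sup>2 / 2)"
        by (simp flip: exp_add)
      then have "std_normal_density (u + s) \<le> exp (- u\<^sup>2 / 2) * std_normal_density s"
        by (simp add: std_normal_density_def divide_right_mono)
      then show ?thesis
        using True by (simp add: ennreal_leI flip: ennreal_mult)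
    qed simp
  qed
  also have "\<dots> = ennreal (exp (- u\<^sup>2 / 2)) * emeasure std_gauss {0..}"
    unfolding * by (simp add: nn_integral_cmult)
  also have "\<dots> = ennreal (exp (- u\<^sup>2 / 2) * gauss_tail 0)"
    unfolding gauss_tail_def by (simp add: std_gauss.emeasure_eq_measure ennreal_mult)
  finally have "ennreal (gauss_tail u) \<le> ennreal (exp (- u\<^sup>2 / 2) / 2)"
    unfolding gauss_tail_0 by (simp add: gauss_tail_def std_gauss.emeasure_eq_measure)
  then show ?thesis
    by (subst (asm) ennreal_le_iff) auto
qed

lemma gauss_tail_antimono: "u \<le> v \<Longrightarrow> gauss_tail v \<le> gauss_tail u"
  unfolding gauss_tail_def by (intro std_gauss.finite_measure_mono) auto

text \<open>The right-hand side has derivative \<pi> \<phi>(u) - sqrt (2 \<pi>) Q(u), with density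
  \<phi> and tail Q. It is nonnegative for u \<ge> 0 by the previous tail bound and nonpositive for u
  \<le> 0, where Q(u) \<ge> 1/2; the minimum is therefore attained at u = 0, with value 1 -
  \<pi>/2.\<close>

lemma gauss_excess_ge:
  "1 - pi / 2 \<le> sqrt (2 * pi) * (std_normal_density u - u * gauss_tail u) - pi * gauss_tail u"
proof -
  let ?D = "\<lambda>u. sqrt (2 * pi) * (std_normal_density u - u * gauss_tail u) - pi * gauss_tail u"
  let ?D' = "\<lambda>u. pi * std_normal_density u - sqrt (2 * pi) * gauss_tail u"
  have deriv: "(?D has_real_derivative ?D' u) (at u)" for u
    by (auto intro!: derivative_eq_intros std_normal_density_has_derivative gauss_tail_has_derivative
        simp: algebra_simps)
  have D': "?D' u = sqrt (2 * pi) * (exp (- u\<^sup>2 / 2) / 2 - gauss_tail u)" for u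
  proof -
    have "pi * std_normal_density u = (sqrt (2 * pi) * sqrt (2 * pi)) / 2 * std_normal_density u"
      by simp
    also have "\<dots> = sqrt (2 * pi) * (exp (- u\<^sup>2 / 2) / 2)"
      unfolding std_normal_density_def by (simp del: real_sqrt_mult_self add: field_simps)
    finally show ?thesis by (simp add: algebra_simps)
  qed
  have D0: "?D 0 = 1 - pi / 2"
    by (simp add: std_normal_density_def)
  show ?thesis
  proof (cases "0 \<le> u")
    case True
    have "?D 0 \<le> ?D u"
    proof (rule DERIV_nonneg_imp_nondecreasing[OF True])
      fix x :: real assume "0 \<le> x"
      then have "0 \<le> ?D' x"
        unfolding D' using gauss_tail_le[of x] by (intro mult_nonneg_nonneg) auto
      then show "\<exists>y. (?D has_real_derivative y) (at x) \<and> 0 \<le> y"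
        using deriv by blast
    qed
    then show ?thesis using D0 by simp
  next
    case False
    then have "u \<le> 0" by simp
    have "?D 0 \<le> ?D u"
    proof (rule DERIV_nonpos_imp_nonincreasing[OF \<open>u \<le> 0\<close>])
      fix x :: real assume "x \<le> 0"
      then have "1 / 2 \<le> gauss_tail x"
        using gauss_tail_antimono[of x 0] by simp
      moreover have "exp (- x\<^sup>2 / 2) \<le> 1"
        by (subst exp_le_one_iff) simp
      ultimately have "exp (- x\<^sup>2 / 2) / 2 - gauss_tail x \<le> 0"
        by linarith
      then have "?D' x \<le> 0"
        unfolding D' by (intro mult_nonneg_nonpos) auto
      then show "\<exists>y. (?D has_real_derivative y) (at x) \<and> y \<le> 0"
        using deriv by blast
    qed
    then show ?thesis using D0 by simp
  qed
qed

text \<open>A first order Taylor expansion of the tail with a crude error term, uniform in u because the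
  normal density has slope at most 1.\<close>

lemma gauss_tail_shift_le:
  assumes "0 \<le> h"
  shows "gauss_tail (u + h) \<le> gauss_tail u - h * std_normal_density u + h\<^sup>2"
proof -
  have der1: "\<bar>x * std_normal_density x\<bar> \<le> 1" for x
  proof -
    have "\<bar>x\<bar> \<le> 1 + x\<^sup>2 / 2"
      using zero_le_power2[of "\<bar>x\<bar> - 1"] by (simp add: power2_eq_square algebra_simps)
    also have "\<dots> \<le> exp (x\<^sup>2 / 2)"
      by (rule exp_ge_add_one_self)
    finally have "\<bar>x\<bar> * exp (- (x\<^sup>2 / 2)) \<le> exp (x\<^sup>2 / 2) * exp (- (x\<^sup>2 / 2))"
      by (rule mult_right_mono) simp
    then have "\<bar>x\<bar> * exp (- (x\<^sup>2 / 2)) \<le> 1"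
      by (simp flip: exp_add)
    moreover have "1 \<le> sqrt (2 * pi)"
      using pi_gt3 by (simp add: real_le_rsqrt)
    ultimately have "\<bar>x\<bar> * exp (- (x\<^sup>2 / 2)) \<le> sqrt (2 * pi)"
      by linarith
    then show ?thesis
      by (simp add: std_normal_density_def abs_mult field_simps)
  qed
  have lip: "std_normal_density u - std_normal_density (u + s) \<le> s" if "0 \<le> s" for s
  proof -
    have "(\<lambda>x. std_normal_density x + x) u \<le> (\<lambda>x. std_normal_density x + x) (u + s)"
    proof (rule DERIV_nonneg_imp_nondecreasing[where f = "\<lambda>x. std_normal_density x + x"])
      fix x
      have "((\<lambda>x. std_normal_density x + x) has_real_derivative - x * std_normal_density x + 1) (at x)"
        by (auto intro!: derivative_eq_intros std_normal_density_has_derivative)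
      moreover have "0 \<le> - x * std_normal_density x + 1"
        using der1[of x] by (simp add: abs_le_iff)
      ultimately show "\<exists>y. ((\<lambda>x. std_normal_density x + x) has_real_derivative y) (at x) \<and> 0 \<le> y"
        by blast
    qed (use that in simp)
    then show ?thesis by simp
  qed
  let ?F = "\<lambda>s. gauss_tail u - s * std_normal_density u + s\<^sup>2 - gauss_tail (u + s)"
  have "?F 0 \<le> ?F h"
  proof (rule DERIV_nonneg_imp_nondecreasing[OF assms])
    fix s :: real assume "0 \<le> s"
    have "((\<lambda>s. gauss_tail (u + s)) has_real_derivative - std_normal_density (u + s)) (at s)"
      using gauss_tail_has_derivative[of "u + s"] by (simp add: DERIV_shift add.commute[of u])
    then have "(?F has_real_derivative (- std_normal_density u + 2 * s + std_normal_density (u + s))) (at s)"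
      by (auto intro!: derivative_eq_intros)
    moreover have "0 \<le> - std_normal_density u + 2 * s + std_normal_density (u + s)"
      using lip[OF \<open>0 \<le> s\<close>] \<open>0 \<le> s\<close> by simp
    ultimately show "\<exists>y. (?F has_real_derivative y) (at s) \<and> 0 \<le> y" by blast
  qed
  then show ?thesis by simp
qed

lemma std_gauss_tail_moment:
  "(\<integral>s. s * indicator {u..} s \<partial>std_gauss) = std_normal_density u"
proof -
  have int: "integrable lborel (\<lambda>s. std_normal_density s * s)"
    by (rule integrable_normal_moment_nz_1) simp
  have "(\<integral>s. s * indicator {u..} s \<partial>std_gauss) = (\<integral>s. std_normal_density s * (s * indicator {u..} s) \<partial>lborel)"
    by (subst integral_density) auto
  also have "\<dots> = (\<integral>s. indicator {u<..} s *\<^sub>R (std_normal_density s * s) \<partial>lborel)"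
    by (intro integral_cong_AE) (auto intro!: eventually_mono[OF AE_lborel_singleton[of u]] simp: indicator_def)
  also have "\<dots> = (LBINT s=ereal u..\<infinity>. std_normal_density s * s)"
    by (simp add: interval_integral_to_infinity_eq set_lebesgue_integral_def)
  also have "\<dots> = 0 - (- std_normal_density u)"
  proof (rule interval_integral_FTC_integrable[where F = "\<lambda>s. - std_normal_density s"])
    fix x
    show "((\<lambda>s. - std_normal_density s) has_vector_derivative std_normal_density x * x) (at x)"
      unfolding has_real_derivative_iff_has_vector_derivative[symmetric]
      by (auto intro!: derivative_eq_intros std_normal_density_has_derivative)
    show "isCont (\<lambda>s. std_normal_density s * s) x"
      unfolding std_normal_density_def by (intro continuous_intros) auto
  next
    show "set_integrable lborel (einterval (ereal u) \<infinity>) (\<lambda>s. std_normal_density s * s)"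
      unfolding set_integrable_def by (intro integrable_mult_indicator int) auto
    have "((\<lambda>s. - std_normal_density s) \<longlongrightarrow> - std_normal_density u) (at_right u)"
      unfolding std_normal_density_def by (intro tendsto_intros) auto
    then show "(((\<lambda>s. - std_normal_density s) \<circ> real_of_ereal) \<longlongrightarrow> - std_normal_density u) (at_right (ereal u))"
      by (simp add: ereal_tendsto_simps comp_assoc)
    have "((\<lambda>s. - std_normal_density s) \<longlongrightarrow> 0) at_top"
      unfolding std_normal_density_def by real_asymp
    then show "(((\<lambda>s. - std_normal_density s) \<circ> real_of_ereal) \<longlongrightarrow> 0) (at_left \<infinity>)"
      by (simp add: ereal_tendsto_simps comp_assoc)
  qed simp
  finally show ?thesis by simp
qed

section \<open>Half cylinders\<close>

text \<open>Prekopa-Leindler applied to the Gaussian density restricted to A, B and M. The density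
  itself is log-concave by the parallelogram identity.\<close>

lemma gauss_log_concave:
  fixes A B M :: "(real ^ 'n) set"
  assumes [measurable]: "A \<in> sets borel" "B \<in> sets borel" "M \<in> sets borel"
    and mid: "\<And>x y. x \<in> A \<Longrightarrow> y \<in> B \<Longrightarrow> (1 / 2) *\<^sub>R (x + y) \<in> M"
  shows "measure gauss_measure A * measure gauss_measure B \<le> (measure gauss_measure M)\<^sup>2"
proof -
  let ?f = "\<lambda>A x. ennreal (gauss_dens x) * indicator A x"
  have dens: "gauss_dens x * gauss_dens y \<le> (gauss_dens ((1 / 2) *\<^sub>R (x + y)))\<^sup>2" for x y :: "real ^ 'n"
  proof -
    let ?k = "(2 * pi) powr (- real CARD('n) / 2)"
    have "0 \<le> (x - y) \<bullet> (x - y)" by simp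
    then have "- (norm x)\<^sup>2 / 2 + - (norm y)\<^sup>2 / 2 \<le> 2 * (- (norm ((1 / 2) *\<^sub>R (x + y)))\<^sup>2 / 2)"
      unfolding power2_norm_eq_inner by (simp add: inner_simps inner_commute field_simps)
    then have "exp (- (norm x)\<^sup>2 / 2) * exp (- (norm y)\<^sup>2 / 2) \<le> (exp (- (norm ((1 / 2) *\<^sub>R (x + y)))\<^sup>2 / 2))\<^sup>2"
      unfolding exp_add[symmetric] exp_double[symmetric] by (simp only: exp_le_cancel_iff)
    then have "?k\<^sup>2 * (exp (- (norm x)\<^sup>2 / 2) * exp (- (norm y)\<^sup>2 / 2))
        \<le> ?k\<^sup>2 * (exp (- (norm ((1 / 2) *\<^sub>R (x + y)))\<^sup>2 / 2))\<^sup>2"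
      by (rule mult_left_mono) simp
    then show ?thesis
      by (simp add: gauss_dens_def power2_eq_square ac_simps)
  qed
  have "(\<integral>\<^sup>+x. ?f A x \<partial>lborel) * (\<integral>\<^sup>+x. ?f B x \<partial>lborel) \<le> (\<integral>\<^sup>+x. ?f M x \<partial>lborel)\<^sup>2"
  proof (rule prekopa_leindler)
    fix x y :: "real ^ 'n"
    show "?f A x * ?f B y \<le> (?f M ((1 / 2) *\<^sub>R (x + y)))\<^sup>2"
    proof (cases "x \<in> A \<and> y \<in> B")
      case True
      then have "(1 / 2) *\<^sub>R (x + y) \<in> M"
        using mid by blast
      then show ?thesis
        using True dens[of x y] by (simp add: ennreal_power gauss_dens_pos less_imp_le flip: ennreal_mult)
    qed auto
  qed measurable
  moreover have "(\<integral>\<^sup>+x. ?f E x \<partial>lborel)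
      = ennreal (measure gauss_measure E)" if [measurable]: "E \<in> sets borel" for E :: "(real ^ 'n) set"
  proof -
    have "ennreal (measure gauss_measure E) = emeasure gauss_measure E"
      by (rule gauss.emeasure_eq_measure[symmetric])
    also have "\<dots> = (\<integral>\<^sup>+x. ?f E x \<partial>lborel)"
      by (simp add: gauss_measure_eq emeasure_density)
    finally show ?thesis ..
  qed
  ultimately show ?thesis
    by (simp add: ennreal_power flip: ennreal_mult)
qed

text \<open>The convex set D is a union of lines parallel to the unit vector a, and b \<bullet> x serves
  as the coordinate along these lines. For a cone with generators a i and dual basis b i, the wedge
  obtained by dropping the condition on the i-th coordinate is such a D, and the cone is its half
  cylinder at height 0.\<close>

locale gauss_half_cylinder =
  fixes a b :: "real ^ 'n" and D :: "(real ^ 'n) set"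
  assumes norm_a: "norm a = 1" and b_a: "b \<bullet> a = 1"
    and D_meas [measurable]: "D \<in> sets borel" and D_convex: "convex D"
    and D_shift: "x \<in> D \<Longrightarrow> x + s *\<^sub>R a \<in> D"
begin

definition half_cylinder :: "real \<Rightarrow> (real ^ 'n) set" where
  "half_cylinder r = {x \<in> D. r \<le> b \<bullet> x}"

lemma half_cylinder_meas [measurable]: "half_cylinder r \<in> sets borel"
proof -
  have "{x \<in> space borel. x \<in> D \<and> r \<le> b \<bullet> x} \<in> sets borel"
    by measurable
  then show ?thesis by (simp add: half_cylinder_def)
qed

lemma a_a: "a \<bullet> a = 1"
  using norm_a by (simp add: norm_eq_1)

lemma D_shift_iff: "x + s *\<^sub>R a \<in> D \<longleftrightarrow> x \<in> D"
  using D_shift[of x s] D_shift[of "x + s *\<^sub>R a" "- s"] by auto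

text \<open>On the line through x in direction a, the set D is everything or nothing, and the half
  cylinder is the ray starting at the height ((a - b) \<bullet> x) + r, which depends only on the line.
  All integrals below are computed line by line from this.\<close>

lemma fibre_half_cylinder: "x + (s - a \<bullet> x) *\<^sub>R a \<in> half_cylinder r \<longleftrightarrow> x \<in> D \<and> (a - b) \<bullet> x + r \<le> s"
  by (auto simp: half_cylinder_def D_shift_iff inner_simps b_a)

lemma integrable_D_bounded:
  fixes f :: "real \<Rightarrow> real"
  assumes [measurable]: "f \<in> borel_measurable borel" and "\<And>v. \<bar>f v\<bar> \<le> K"
  shows "integrable gauss_measure (\<lambda>x. indicator D x * f ((a - b) \<bullet> x))"
proof (rule gauss.integrable_const_bound[where B = K])
  show "AE x in gauss_measure. norm (indicator D x * f ((a - b) \<bullet> x)) \<le> K"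
    using assms(2) order_trans[OF abs_ge_zero assms(2)] by (intro AE_I2) (auto simp: indicator_def)
qed measurable

lemma gauss_tail_meas [measurable]: "gauss_tail \<in> borel_measurable borel"
  by (intro borel_measurable_continuous_onI continuous_at_imp_continuous_on ballI
      DERIV_isCont[OF gauss_tail_has_derivative])

lemma gauss_tail_bound: "\<bar>gauss_tail u\<bar> \<le> 1"
  by (simp add: gauss_tail_def)

lemma std_normal_density_bound: "\<bar>std_normal_density u\<bar> \<le> 1 / sqrt (2 * pi)"
  using std_normal_density_le[of u] by simp

lemma integrable_tail: "integrable gauss_measure (\<lambda>x. indicator D x * gauss_tail ((a - b) \<bullet> x + r))"
  by (rule integrable_D_bounded[where f = "\<lambda>v. gauss_tail (v + r)" and K = 1]) (auto simp: gauss_tail_bound)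

lemma integrable_density: "integrable gauss_measure (\<lambda>x. indicator D x * std_normal_density ((a - b) \<bullet> x))"
  by (rule integrable_D_bounded[OF _ std_normal_density_bound]) simp

lemma integrable_D_const: "integrable gauss_measure (\<lambda>x. indicator D x * (c :: real))"
  by (rule integrable_D_bounded[where f = "\<lambda>_. c" and K = "\<bar>c\<bar>"]) auto

lemma measure_half_cylinder: "measure gauss_measure (half_cylinder r)
    = (\<integral>x. indicator D x * gauss_tail ((a - b) \<bullet> x + r) \<partial>gauss_measure)"
proof -
  have "measure gauss_measure (half_cylinder r) = (\<integral>x. indicator (half_cylinder r) x \<partial>gauss_measure)"
    by simp
  also have "\<dots> = (\<integral>x. (\<integral>s. indicator (half_cylinder r) (x + (s - a \<bullet> x) *\<^sub>R a) \<partial>std_gauss) \<partial>gauss_measure)"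
    by (rule gauss_fibre_integral[OF norm_a]) (simp add: gauss.emeasure_eq_measure)
  also have "(\<lambda>x. \<integral>s. (indicator (half_cylinder r) (x + (s - a \<bullet> x) *\<^sub>R a) :: real) \<partial>std_gauss)
      = (\<lambda>x. \<integral>s. indicator D x * indicator {(a - b) \<bullet> x + r..} s \<partial>std_gauss)"
    by (intro ext Bochner_Integration.integral_cong refl) (auto simp: indicator_def fibre_half_cylinder)
  finally show ?thesis
    by (simp add: gauss_tail_def)
qed

lemma moment_a: "(\<integral>x. (a \<bullet> x) * indicator (half_cylinder 0) x \<partial>gauss_measure)
    = (\<integral>x. indicator D x * std_normal_density ((a - b) \<bullet> x) \<partial>gauss_measure)"
proof -
  have "(\<integral>x. (a \<bullet> x) * indicator (half_cylinder 0) x \<partial>gauss_measure)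
      = (\<integral>x. (\<integral>s. (a \<bullet> (x + (s - a \<bullet> x) *\<^sub>R a)) * indicator (half_cylinder 0) (x + (s
          - a \<bullet> x) *\<^sub>R a) \<partial>std_gauss) \<partial>gauss_measure)"
    by (rule gauss_fibre_integral[OF norm_a])
      (auto intro!: integrable_real_mult_indicator integrable_gauss_inner)
  also have "(\<lambda>x. \<integral>s. (a \<bullet> (x + (s - a \<bullet> x) *\<^sub>R a)) * indicator (half_cylinder 0) (x + (s
      - a \<bullet> x) *\<^sub>R a) \<partial>std_gauss)
      = (\<lambda>x. \<integral>s. indicator D x * (s * indicator {(a - b) \<bullet> x..} s) \<partial>std_gauss)"
    by (intro ext Bochner_Integration.integral_cong refl)
      (simp add: indicator_def fibre_half_cylinder, simp add: inner_simps a_a)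
  finally show ?thesis
    by (simp add: std_gauss_tail_moment)
qed

lemma moment_b:
  "integrable gauss_measure (\<lambda>x. indicator D x *
      (std_normal_density ((a - b) \<bullet> x) - ((a - b) \<bullet> x) * gauss_tail ((a - b) \<bullet> x)))" (is ?I)
  "(\<integral>x. (b \<bullet> x) * indicator (half_cylinder 0) x \<partial>gauss_measure)
    = (\<integral>x. indicator D x *
      (std_normal_density ((a - b) \<bullet> x) - ((a - b) \<bullet> x) * gauss_tail ((a - b) \<bullet> x)) \<partial>gauss_measure)" (is ?E)
proof -
  have int: "integrable gauss_measure (\<lambda>x. (b \<bullet> x) * indicator (half_cylinder 0) x)"
    by (auto intro!: integrable_real_mult_indicator integrable_gauss_inner)
  have eq: "(\<lambda>x. \<integral>s. (b \<bullet> (x + (s - a \<bullet> x) *\<^sub>R a)) * indicator (half_cylinder 0) (x + (s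
      - a \<bullet> x) *\<^sub>R a) \<partial>std_gauss)
      = (\<lambda>x. indicator D x *
      (std_normal_density ((a - b) \<bullet> x) - ((a - b) \<bullet> x) * gauss_tail ((a - b) \<bullet> x)))"
  proof
    fix x
    let ?u = "(a - b) \<bullet> x"
    have "(\<integral>s. (b \<bullet> (x + (s - a \<bullet> x) *\<^sub>R a)) * indicator (half_cylinder 0) (x + (s - a \<bullet> x) *\<^sub>R a) \<partial>std_gauss)
        = (\<integral>s. indicator D x * (s * indicator {?u..} s - ?u * indicator {?u..} s) \<partial>std_gauss)"
      by (intro Bochner_Integration.integral_cong refl)
        (simp add: indicator_def fibre_half_cylinder, simp add: inner_simps b_a)
    also have "\<dots> = indicator D x * ((\<integral>s. s * indicator {?u..} s \<partial>std_gauss)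
        - (\<integral>s. ?u * indicator {?u..} s \<partial>std_gauss))"
      by (subst integral_mult_right_zero, subst Bochner_Integration.integral_diff)
        (auto intro!: integrable_real_mult_indicator integrable_std_gauss_id integrable_mult_right
          integrable_real_indicator simp: std_gauss.emeasure_eq_measure simp del: integrable_mult_right_iff)
    finally show "(\<integral>s. (b \<bullet> (x + (s - a \<bullet> x) *\<^sub>R a)) * indicator (half_cylinder 0) (x + (s
        - a \<bullet> x) *\<^sub>R a) \<partial>std_gauss)
        = indicator D x * (std_normal_density ?u - ?u * gauss_tail ?u)"
      by (simp add: std_gauss_tail_moment gauss_tail_def)
  qed
  show ?I
    using gauss_fibre_integral(1)[OF norm_a int] unfolding eq .
  show ?E
    using gauss_fibre_integral(2)[OF norm_a int] unfolding eq .
qed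

lemma moment_a_le:
  "(\<integral>x. (a \<bullet> x) * indicator (half_cylinder 0) x \<partial>gauss_measure) \<le> measure gauss_measure D / sqrt (2 * pi)"
proof -
  have "(\<integral>x. (a \<bullet> x) * indicator (half_cylinder 0) x \<partial>gauss_measure)
      \<le> (\<integral>x. indicator D x * (1 / sqrt (2 * pi)) \<partial>gauss_measure)"
    unfolding moment_a
    by (intro integral_mono integrable_density integrable_D_const)
      (use std_normal_density_le in \<open>auto simp: indicator_def\<close>)
  then show ?thesis by simp
qed

text \<open>Equality in the previous bound means that the density \<phi> is at its maximum \<phi>(0) on
  almost every line, so (a - b) \<bullet> x = 0 almost everywhere on a set with interior points.\<close>

lemma moment_a_eq:
  assumes eq: "(\<integral>x. (a \<bullet> x) * indicator (half_cylinder 0) x \<partial>gauss_measure)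
      = measure gauss_measure D / sqrt (2 * pi)"
    and int: "interior D \<noteq> {}"
  shows "a = b"
proof (rule ccontr)
  assume "a \<noteq> b"
  let ?u = "\<lambda>x. (a - b) \<bullet> x"
  let ?d = "\<lambda>x. indicator D x * (1 / sqrt (2 * pi)) - indicator D x * std_normal_density (?u x)"
  note iD = integrable_D_const
  have "(\<integral>x. ?d x \<partial>gauss_measure) = 0"
    using eq unfolding moment_a by (subst Bochner_Integration.integral_diff[OF iD integrable_density]) simp
  moreover have "0 \<le> ?d x" for x
    using std_normal_density_le[of "?u x"] by (simp add: indicator_def)
  ultimately have "AE x in gauss_measure. ?d x = 0"
    using integral_nonneg_eq_0_iff_AE[of gauss_measure ?d]
      Bochner_Integration.integrable_diff[OF iD[of "1 / sqrt (2 * pi)"] integrable_density] by blast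
  moreover have "?u x = 0" if "?d x = 0" "x \<in> D" for x
    using that by (simp add: std_normal_density_def)
  ultimately have "AE x in gauss_measure. x \<notin> D \<or> ?u x = 0"
    by (auto elim: eventually_mono)
  then have "AE x in gauss_measure. x \<notin> interior D - {x. ?u x = 0}"
    using interior_subset[of D] by (auto elim: eventually_mono)
  then have "measure gauss_measure (interior D - {x. ?u x = 0}) = 0"
    by (subst (asm) AE_iff_measurable[of "interior D - {x. ?u x = 0}"]) (auto simp: measure_def)
  moreover have "measure gauss_measure (interior D - {x. ?u x
      = 0}) \<ge> measure gauss_measure (interior D) - measure gauss_measure {x. ?u x = 0}"
    using gauss.finite_measure_Diff'[of "interior D" "{x. ?u x = 0}"]
      gauss.finite_measure_mono[of "interior D \<inter> {x. ?u x = 0}" "{x. ?u x = 0}"] by simp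
  moreover have "0 < measure gauss_measure (interior D)"
    using gauss_open_pos[of "interior D"] int by simp
  ultimately show False
    using gauss_hyperplane_null[of "a - b"] \<open>a \<noteq> b\<close> by simp
qed

text \<open>The tangent inequality \<open>gauss_excess_ge\<close> integrated over the lines in
  D.\<close>

lemma moment_b_ge:
  "measure gauss_measure D + pi * (measure gauss_measure (half_cylinder 0) - measure gauss_measure D / 2)
    \<le> sqrt (2 * pi) * (\<integral>x. (b \<bullet> x) * indicator (half_cylinder 0) x \<partial>gauss_measure)"
proof -
  let ?u = "\<lambda>x. (a - b) \<bullet> x"
  let ?e = "\<lambda>u. std_normal_density u - u * gauss_tail u"
  note iD = integrable_D_const
  have "measure gauss_measure D * (1 - pi / 2) = (\<integral>x. indicator D x * (1 - pi / 2) \<partial>gauss_measure)"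
    by (subst integral_mult_left_zero) simp
  also have "\<dots> \<le> (\<integral>x. sqrt (2 * pi) * (indicator D x * ?e (?u x)) - pi * (indicator D x * gauss_tail (?u x
      + 0)) \<partial>gauss_measure)"
  proof (intro integral_mono iD Bochner_Integration.integrable_diff integrable_mult_right moment_b
      integrable_tail)
    fix x
    show "indicator D x * (1 - pi / 2)
        \<le> sqrt (2 * pi) * (indicator D x * ?e (?u x)) - pi * (indicator D x * gauss_tail (?u x + 0))"
      using gauss_excess_ge[of "?u x"] by (simp add: indicator_def)
  qed
  also have "\<dots> = sqrt (2 * pi) * (\<integral>x. (b \<bullet> x) * indicator (half_cylinder 0) x \<partial>gauss_measure)
      - pi * measure gauss_measure (half_cylinder 0)"
    unfolding moment_b(2) measure_half_cylinder
    by (subst Bochner_Integration.integral_diff)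
      (auto intro!: moment_b(1) integrable_tail integrable_mult_right simp del: add_0_right)
  finally show ?thesis
    by (simp add: algebra_simps)
qed

text \<open>Since D is convex and the coordinate b is linear, the midpoint of a point of height at least
  0 and one of height at least r has height at least r/2: the measure of the half cylinder is
  log-concave in r.\<close>

lemma measure_half_cylinder_half: "measure gauss_measure (half_cylinder 0) * measure gauss_measure
    (half_cylinder r) \<le> (measure gauss_measure (half_cylinder (r / 2)))\<^sup>2"
proof (rule gauss_log_concave)
  fix x y assume xy: "x \<in> half_cylinder 0" "y \<in> half_cylinder r"
  have "(1 / 2) *\<^sub>R x + (1 / 2) *\<^sub>R y \<in> D"
    using xy by (intro convexD[OF D_convex]) (auto simp: half_cylinder_def)
  then show "(1 / 2) *\<^sub>R (x + y) \<in> half_cylinder (r / 2)"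
    using xy by (simp add: half_cylinder_def inner_simps scaleR_add_right)
qed auto

lemma measure_half_cylinder_le:
  assumes "0 \<le> h"
  shows "measure gauss_measure (half_cylinder h) \<le> measure gauss_measure (half_cylinder 0)
    - h * (\<integral>x. (a \<bullet> x) * indicator (half_cylinder 0) x \<partial>gauss_measure) + h\<^sup>2"
proof -
  let ?u = "\<lambda>x. (a - b) \<bullet> x"
  note iD = integrable_D_const
  have "measure gauss_measure (half_cylinder h) \<le> (\<integral>x. indicator D x * gauss_tail (?u x + 0)
      - h * (indicator D x * std_normal_density (?u x)) + indicator D x * h\<^sup>2 \<partial>gauss_measure)"
    unfolding measure_half_cylinder
  proof (intro integral_mono Bochner_Integration.integrable_add Bochner_Integration.integrable_diff
      integrable_mult_right integrable_tail integrable_density iD)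
    fix x
    show "indicator D x * gauss_tail (?u x + h) \<le> indicator D x * gauss_tail (?u x + 0)
      - h * (indicator D x * std_normal_density (?u x)) + indicator D x * h\<^sup>2"
      using gauss_tail_shift_le[OF assms, of "?u x"] by (simp add: indicator_def)
  qed
  also have "\<dots> = measure gauss_measure (half_cylinder 0)
      - h * (\<integral>x. (a \<bullet> x) * indicator (half_cylinder 0) x \<partial>gauss_measure)
      + h\<^sup>2 * measure gauss_measure D"
    unfolding measure_half_cylinder moment_a
    by (subst Bochner_Integration.integral_add, (intro Bochner_Integration.integrable_diff
      integrable_mult_right integrable_tail integrable_density iD)+,
      subst Bochner_Integration.integral_diff,
          (intro integrable_mult_right integrable_tail integrable_density)+)
      (simp add: mult.commute)
  also have "\<dots> \<le> measure gauss_measure (half_cylinder 0)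
      - h * (\<integral>x. (a \<bullet> x) * indicator (half_cylinder 0) x \<partial>gauss_measure) + h\<^sup>2"
    using mult_left_mono[of "measure gauss_measure D" 1 "h\<^sup>2"] by simp
  finally show ?thesis .
qed

text \<open>A log-concave function of r lies below the exponential with the same value and the same
  derivative at 0, where \<sigma> is the relative rate of decay. Halving r repeatedly reduces the claim
  to the first order bound \<open>measure_half_cylinder_le\<close>.\<close>

lemma measure_half_cylinder_exp:
  assumes "0 \<le> r" and p: "0 < measure gauss_measure (half_cylinder 0)"
  defines "\<sigma> \<equiv> (\<integral>x. (a \<bullet> x) * indicator (half_cylinder 0) x \<partial>gauss_measure) / measure gauss_measure
      (half_cylinder 0)"
  shows "measure gauss_measure (half_cylinder r) \<le> measure gauss_measure (half_cylinder 0) * exp (- r * \<sigma>)"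
proof -
  let ?p = "measure gauss_measure (half_cylinder 0)" and ?K
      = "\<lambda>r. measure gauss_measure (half_cylinder r) / measure gauss_measure (half_cylinder 0)"
  have half: "?K t \<le> (?K (t / 2))\<^sup>2" for t
    using measure_half_cylinder_half[of t] p by (simp add: field_simps power2_eq_square)
  have iter: "?K r \<le> (?K (r / 2 ^ n)) ^ (2 ^ n)" for n
  proof (induction n)
    case (Suc n)
    have "(?K (r / 2 ^ n)) ^ (2 ^ n) \<le> ((?K (r / 2 ^ n / 2))\<^sup>2) ^ (2 ^ n)"
      by (intro power_mono half) simp
    also have "\<dots> = (?K (r / 2 ^ Suc n)) ^ (2 ^ Suc n)"
      by (simp add: power_mult[symmetric] mult.commute)
    finally show ?case using Suc by linarith
  qed simp
  have small: "?K h \<le> exp (- h * \<sigma> + h\<^sup>2 / ?p)" if "0 \<le> h" for h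
  proof -
    have "?K h \<le> (?p - h * (\<integral>x. (a \<bullet> x) * indicator (half_cylinder 0) x \<partial>gauss_measure) + h\<^sup>2) / ?p"
      using measure_half_cylinder_le[OF that] p by (intro divide_right_mono) auto
    also have "\<dots> = 1 + (- h * \<sigma> + h\<^sup>2 / ?p)"
      using p by (simp add: \<sigma>_def field_simps)
    also have "\<dots> \<le> exp (- h * \<sigma> + h\<^sup>2 / ?p)"
      by (rule exp_ge_add_one_self)
    finally show ?thesis .
  qed
  have bnd: "?K r \<le> exp (- r * \<sigma> + (r\<^sup>2 / ?p) * (1 / 2) ^ n)" for n
  proof -
    have "?K r \<le> (?K (r / 2 ^ n)) ^ (2 ^ n)" by (rule iter)
    also have "\<dots> \<le> (exp (- (r / 2 ^ n) * \<sigma> + (r / 2 ^ n)\<^sup>2 / ?p)) ^ (2 ^ n)"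
      using assms(1) by (intro power_mono small) auto
    also have "\<dots> = exp (2 ^ n * (- (r / 2 ^ n) * \<sigma> + (r / 2 ^ n)\<^sup>2 / ?p))"
      by (simp add: exp_of_nat_mult[symmetric])
    also have "2 ^ n * (- (r / 2 ^ n) * \<sigma> + (r / 2 ^ n)\<^sup>2 / ?p) = - r * \<sigma> + (r\<^sup>2 / ?p) * (1 / 2) ^ n"
      by (simp add: field_simps power2_eq_square)
    finally show ?thesis .
  qed
  have "(\<lambda>n. exp (- r * \<sigma> + (r\<^sup>2 / ?p) * (1 / 2) ^ n)) \<longlonglongrightarrow> exp (- r * \<sigma> + (r\<^sup>2 / ?p) * 0)"
    by (intro tendsto_intros LIMSEQ_power_zero) simp
  then have "?K r \<le> exp (- r * \<sigma> + (r\<^sup>2 / ?p) * 0)"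
    using bnd by (intro LIMSEQ_le_const) auto
  then show ?thesis
    using p by (simp add: field_simps)
qed

lemma moment_b_nonneg: "0 \<le> (\<integral>x. (b \<bullet> x) * indicator (half_cylinder 0) x \<partial>gauss_measure)"
  by (intro integral_nonneg_AE AE_I2) (simp add: half_cylinder_def indicator_def)

text \<open>The moment in direction b is the integral over r \<ge> 0 of the measure of the half cylinder
  at height r, and by the exponential bound this is at most p / \<sigma> with p the measure at height
  0.\<close>

lemma moment_product_le:
  "(\<integral>x. (b \<bullet> x) * indicator (half_cylinder 0) x \<partial>gauss_measure) * (\<integral>x. (a \<bullet> x) * indicator
      (half_cylinder 0) x \<partial>gauss_measure)
    \<le> (measure gauss_measure (half_cylinder 0))\<^sup>2"
proof -
  let ?A = "\<integral>x. (b \<bullet> x) * indicator (half_cylinder 0) x \<partial>gauss_measure" and ?S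
      = "\<integral>x. (a \<bullet> x) * indicator (half_cylinder 0) x \<partial>gauss_measure"
    and ?p = "measure gauss_measure (half_cylinder 0)"
  show ?thesis
  proof (cases "0 < ?S")
    case False
    then show ?thesis
      using moment_b_nonneg by (intro order_trans[OF mult_nonneg_nonpos zero_le_power2]) auto
  next
    case S: True
    have "0 < ?p"
    proof (rule ccontr)
      assume "\<not> 0 < ?p"
      then have "emeasure gauss_measure (half_cylinder 0) = 0"
        using measure_nonneg[of gauss_measure "half_cylinder 0"]
        by (simp only: gauss.emeasure_eq_measure not_less) simp
      then have "AE x in gauss_measure. x \<notin> half_cylinder 0"
        by (subst AE_iff_measurable[of "half_cylinder 0"]) auto
      then have "?S = (\<integral>x. 0 \<partial>(gauss_measure :: (real ^ 'n) measure))"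
        by (intro integral_cong_AE) auto
      then show False using S by simp
    qed
    note p = this
    define \<sigma> where "\<sigma> = ?S / ?p"
    have \<sigma>: "0 < \<sigma>" using S p by (simp add: \<sigma>_def)
    have int: "integrable gauss_measure (\<lambda>x. (b \<bullet> x) * indicator (half_cylinder 0) x)"
      by (auto intro!: integrable_real_mult_indicator integrable_gauss_inner)
    have "ennreal ?A = (\<integral>\<^sup>+x. ennreal ((b \<bullet> x) * indicator (half_cylinder 0) x) \<partial>gauss_measure)"
      by (rule nn_integral_eq_integral[symmetric, OF int]) (auto simp: half_cylinder_def indicator_def)
    also have "\<dots> = (\<integral>\<^sup>+x. (\<integral>\<^sup>+r. indicator {0..} r * indicator (half_cylinder r) x \<partial>lborel) \<partial>gauss_measure)"
    proof (rule nn_integral_cong)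
      fix x
      have "(\<lambda>r. indicator {0..} r * indicator (half_cylinder r) x)
          = (if x \<in> half_cylinder 0 then indicator {0..b \<bullet> x} else (\<lambda>_. 0) :: real \<Rightarrow> ennreal)"
        by (auto simp: fun_eq_iff half_cylinder_def indicator_def)
      then show "ennreal ((b \<bullet> x) * indicator (half_cylinder 0) x)
          = (\<integral>\<^sup>+r. indicator {0..} r * indicator (half_cylinder r) x \<partial>lborel)"
        by (auto simp: half_cylinder_def)
    qed
    also have "\<dots> = (\<integral>\<^sup>+r. (\<integral>\<^sup>+x. indicator {0..} r * indicator (half_cylinder r) x \<partial>gauss_measure) \<partial>lborel)"
    proof -
      interpret pair_sigma_finite lborel "gauss_measure :: (real ^ 'n) measure" ..
      have [measurable]: "(\<lambda>p. indicator (half_cylinder (fst p)) (snd p) :: ennreal) \<in> borel_measurable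
          (lborel \<Otimes>\<^sub>M gauss_measure)"
        unfolding half_cylinder_def by (simp add: indicator_def)
      show ?thesis
        by (rule Fubini') (simp add: case_prod_unfold)
    qed
    also have "\<dots> = (\<integral>\<^sup>+r. indicator {0..} r * ennreal (measure gauss_measure (half_cylinder r)) \<partial>lborel)"
      by (intro nn_integral_cong) (simp add: nn_integral_cmult gauss.emeasure_eq_measure)
    also have "\<dots> \<le> (\<integral>\<^sup>+r. ennreal (?p / \<sigma>) * ennreal (exponential_density \<sigma> r) \<partial>lborel)"
    proof (intro nn_integral_mono)
      fix r :: real
      show "indicator {0..} r * ennreal (measure gauss_measure (half_cylinder r))
          \<le> ennreal (?p / \<sigma>) * ennreal (exponential_density \<sigma> r)"
      proof (cases "0 \<le> r")
        case True
        then have "ennreal (measure gauss_measure (half_cylinder r)) \<le> ennreal (?p * exp (- r * \<sigma>))"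
          using measure_half_cylinder_exp[OF True p] by (intro ennreal_leI) (simp add: \<sigma>_def)
        also have "?p * exp (- r * \<sigma>) = (?p / \<sigma>) * exponential_density \<sigma> r"
          using True \<sigma> by (simp add: exponential_density_def)
        finally show ?thesis
          using \<sigma> p exponential_density_nonneg[OF \<sigma>, of r] True by (subst ennreal_mult[symmetric]) auto
      qed simp
    qed
    also have "\<dots> = ennreal (?p / \<sigma>) * (\<integral>\<^sup>+r. ennreal (exponential_density \<sigma> r) \<partial>lborel)"
      by (rule nn_integral_cmult) simp
    also have "(\<integral>\<^sup>+r. ennreal (exponential_density \<sigma> r) \<partial>lborel) = 1"
      using prob_space.emeasure_space_1[OF prob_space_exponential_density[OF \<sigma>]]
      by (simp add: emeasure_density)
    finally have "?A \<le> ?p / \<sigma>"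
      using \<sigma> p by (simp add: ennreal_le_iff)
    then show ?thesis
      using S p by (simp add: \<sigma>_def field_simps power2_eq_square)
  qed
qed

end

section \<open>The inequality for a simplicial cone\<close>

text \<open>The contribution of one generator to the inequality for a simplicial cone. For \<theta>
  \<le> 4P the bounds on S and A leave the square (2 \<pi> - 4) (P - \<theta>/2)^2; for \<theta> > 4P,
  where the coefficient of A may be negative, the product bound gives a strict inequality.\<close>

lemma cone_term_ge:
  fixes P \<theta> S A :: real
  assumes P: "0 < P" and \<theta>: "P \<le> \<theta>" and A: "0 \<le> A"
    and S_le: "S \<le> \<theta> / sqrt (2 * pi)"
    and A_ge: "\<theta> + pi * (P - \<theta> / 2) \<le> sqrt (2 * pi) * A"
    and AS: "A * S \<le> P\<^sup>2"
  shows "1 + pi / 2 \<le> sqrt (2 * pi) * A / P - pi / 2 * (A * S) / P\<^sup>2 + pi / 4 * \<theta> / P" (is "_ \<le> ?r")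
    and "1 + pi / 2 = sqrt (2 * pi) * A / P - pi / 2 * (A * S) / P\<^sup>2 + pi / 4 * \<theta> / P \<Longrightarrow> S = \<theta> / sqrt (2 * pi)"
proof -
  \<comment> \<open>Normalized moments: both equal \<theta> when P = \<theta> / 2 and all bounds are attained.\<close>
  define \<alpha> \<kappa> where "\<alpha> = sqrt (2 * pi) * A" and "\<kappa> = sqrt (2 * pi) * S"
  have sq: "sqrt (2 * pi) * sqrt (2 * pi) = 2 * pi" and sq0: "0 < sqrt (2 * pi)"
    by simp_all
  have ak: "\<alpha> * \<kappa> = 2 * pi * (A * S)"
    unfolding \<alpha>_def \<kappa>_def by (metis sq mult.assoc mult.left_commute)
  have \<alpha>: "0 \<le> \<alpha>" "\<theta> + pi * (P - \<theta> / 2) \<le> \<alpha>" and \<kappa>: "\<kappa> \<le> \<theta>" and \<alpha>\<kappa>: "\<alpha> * \<kappa> \<le> 2 * pi * P\<^sup>2"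
    using A A_ge S_le AS ak sq0 by (auto simp: \<alpha>_def \<kappa>_def field_simps)
  define F where "F = \<alpha> * (4 * P - \<kappa>) + pi * \<theta> * P - (4 + 2 * pi) * P\<^sup>2"
  have F: "F = 4 * P\<^sup>2 * (?r - (1 + pi / 2))"
    using P unfolding F_def right_diff_distrib ak by (simp add: \<alpha>_def field_simps power2_eq_square)
  have pi2: "2 < pi" using pi_gt3 by simp
  have "0 \<le> F \<and> (F = 0 \<longrightarrow> \<kappa> = \<theta>)"
  proof (cases "\<theta> \<le> 4 * P")
    case True
    have "(\<theta> + pi * (P - \<theta> / 2)) * (4 * P - \<theta>) \<le> \<alpha> * (4 * P - \<theta>)"
      using True \<alpha> by (intro mult_right_mono) auto
    also have "\<dots> \<le> \<alpha> * (4 * P - \<kappa>)"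
      using \<alpha> \<kappa> by (intro mult_left_mono) auto
    finally have "(2 * pi - 4) * (P - \<theta> / 2)\<^sup>2 \<le> F"
      by (simp add: F_def power2_eq_square field_simps)
    moreover have "0 \<le> (2 * pi - 4) * (P - \<theta> / 2)\<^sup>2"
      using pi2 by simp
    moreover have "\<kappa> = \<theta>" if "(2 * pi - 4) * (P - \<theta> / 2)\<^sup>2 \<le> 0" "F = 0"
    proof -
      have "(P - \<theta> / 2)\<^sup>2 \<le> 0"
        using that(1) pi2 by (simp add: mult_le_0_iff)
      then have P\<theta>: "P = \<theta> / 2"
        by simp
      have "\<theta> * (2 * \<theta> - \<kappa>) \<le> \<alpha> * (2 * \<theta> - \<kappa>)"
        using \<alpha> \<kappa> P\<theta> P by (intro mult_right_mono) auto
      also have "\<dots> = \<theta> * \<theta>"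
        using that(2) unfolding F_def P\<theta> by (simp add: power2_eq_square field_simps)
      finally have "\<theta> * (\<theta> - \<kappa>) \<le> 0"
        by (simp add: algebra_simps)
      then show ?thesis
        using P P\<theta> \<kappa> by (simp add: mult_le_0_iff)
    qed
    ultimately show ?thesis by linarith
  next
    case False
    have "0 < F"
    proof (cases "\<kappa> \<le> 4 * P")
      case True
      have "(4 + 2 * pi) * P \<le> pi * (4 * P)"
        using P pi2 by (simp add: algebra_simps)
      also have "\<dots> < pi * \<theta>"
        using False by simp
      finally have "(4 + 2 * pi) * P * P < pi * \<theta> * P"
        using P by (rule mult_strict_right_mono)
      moreover have "0 \<le> \<alpha> * (4 * P - \<kappa>)"
        using True \<alpha> by simp
      ultimately show ?thesis
        by (simp add: F_def power2_eq_square mult.assoc)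
    next
      case k: False
      have \<theta>0: "0 < \<theta>" using P \<theta> by simp
      have "\<alpha> * (\<kappa> - 4 * P) * \<theta> \<le> \<alpha> * (\<kappa> * (\<theta> - 4 * P))"
      proof -
        have "(\<kappa> - 4 * P) * \<theta> \<le> \<kappa> * (\<theta> - 4 * P)"
          using \<kappa> P by (simp add: algebra_simps)
        then show ?thesis
          using \<alpha> by (simp add: mult.assoc mult_left_mono)
      qed
      also have "\<dots> = (\<alpha> * \<kappa>) * (\<theta> - 4 * P)"
        by simp
      also have "\<dots> \<le> (2 * pi * P\<^sup>2) * (\<theta> - 4 * P)"
        using \<alpha>\<kappa> False by (intro mult_right_mono) auto
      finally have 1: "\<alpha> * (\<kappa> - 4 * P) * \<theta> \<le> (2 * pi * P\<^sup>2) * (\<theta> - 4 * P)" .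
      have "F * \<theta> = pi * \<theta>\<^sup>2 * P - (4 + 2 * pi) * P\<^sup>2 * \<theta> - \<alpha> * (\<kappa> - 4 * P) * \<theta>"
        by (simp add: F_def algebra_simps power2_eq_square)
      moreover have "pi * \<theta>\<^sup>2 * P - (4 + 2 * pi) * P\<^sup>2 * \<theta> - (2 * pi * P\<^sup>2) * (\<theta> - 4 * P)
          = P * (8 * pi * (P - \<theta> / 4)\<^sup>2 + \<theta> * (pi / 2 * \<theta> - 4 * P))"
        by (simp add: field_simps power2_eq_square)
      moreover have "0 < P * (8 * pi * (P - \<theta> / 4)\<^sup>2 + \<theta> * (pi / 2 * \<theta> - 4 * P))"
      proof -
        have "4 * P < \<theta>" using False by simp
        also have "\<theta> \<le> pi / 2 * \<theta>" using pi2 \<theta>0 by (simp add: field_simps)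
        finally have "0 < \<theta> * (pi / 2 * \<theta> - 4 * P)"
          using \<theta>0 by simp
        moreover have "0 \<le> 8 * pi * (P - \<theta> / 4)\<^sup>2"
          by simp
        ultimately have "0 < 8 * pi * (P - \<theta> / 4)\<^sup>2 + \<theta> * (pi / 2 * \<theta> - 4 * P)"
          by linarith
        then show ?thesis
          using P by simp
      qed
      ultimately have "0 < F * \<theta>"
        using 1 by linarith
      then show ?thesis
        using \<theta>0 by (simp add: zero_less_mult_iff)
    qed
    then show ?thesis by simp
  qed
  then have res: "0 \<le> 4 * P\<^sup>2 * (?r - (1 + pi / 2))" "?r = 1 + pi / 2 \<Longrightarrow> \<kappa> = \<theta>"
    using F by auto
  from res(1) show "1 + pi / 2 \<le> ?r"
    using P by (simp add: zero_le_mult_iff)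
  show "S = \<theta> / sqrt (2 * pi)" if "1 + pi / 2 = ?r"
  proof -
    have "\<kappa> = \<theta>" using res(2) that by simp
    then show ?thesis using sq0 by (simp add: \<kappa>_def field_simps)
  qed
qed

text \<open>A basis a together with its dual basis b. The vectors a i generate a simplicial cone,
  described by the nonnegativity of the coordinates b i \<bullet> x; the apex is the point with a i
  \<bullet> apex = 1 for all i.\<close>

locale dual_bases =
  fixes I :: "'i set" and a b :: "'i \<Rightarrow> real ^ 'n"
  assumes fin: "finite I"
    and dual: "i \<in> I \<Longrightarrow> j \<in> I \<Longrightarrow> b i \<bullet> a j = (if i = j then 1 else 0)"
    and expand: "x = (\<Sum>i\<in>I. (b i \<bullet> x) *\<^sub>R a i)"
begin

text \<open>The rank one maps sending x to (b i \<bullet> x) a i add up to the identity; compare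
  traces.\<close>

lemma card_I: "card I = CARD('n)"
proof -
  have "real CARD('n) = (\<Sum>e\<in>(Basis :: (real ^ 'n) set). e \<bullet> e)"
    by simp
  also have "\<dots> = (\<Sum>e\<in>(Basis :: (real ^ 'n) set). \<Sum>i\<in>I. (b i \<bullet> e) * (a i \<bullet> e))"
  proof (rule sum.cong)
    fix e :: "real ^ 'n"
    have "e \<bullet> e = (\<Sum>i\<in>I. (b i \<bullet> e) *\<^sub>R a i) \<bullet> e"
      using expand[of e] by simp
    then show "e \<bullet> e = (\<Sum>i\<in>I. (b i \<bullet> e) * (a i \<bullet> e))"
      by (simp add: inner_sum_left)
  qed simp
  also have "\<dots> = (\<Sum>i\<in>I. b i \<bullet> a i)"
    by (subst sum.swap) (simp add: euclidean_inner[symmetric])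
  also have "\<dots> = real (card I)"
    using dual by simp
  finally show ?thesis by simp
qed

definition simplicial_cone :: "(real ^ 'n) set" where
  "simplicial_cone = {x. \<forall>i\<in>I. 0 \<le> b i \<bullet> x}"

definition wedge :: "'i \<Rightarrow> (real ^ 'n) set" where
  "wedge i = {x. \<forall>j\<in>I - {i}. 0 \<le> b j \<bullet> x}"

definition apex :: "real ^ 'n" where
  "apex = (\<Sum>i\<in>I. b i)"

lemma closed_cone: "closed simplicial_cone" and closed_wedge: "closed (wedge i)"
  unfolding simplicial_cone_def wedge_def Collect_ball_eq
  by (auto intro!: closed_INT closed_Collect_le continuous_intros)

lemma cone_meas [measurable]: "simplicial_cone \<in> sets borel"
  and wedge_meas [measurable]: "wedge i \<in> sets borel"
  by (rule borel_closed[OF closed_cone], rule borel_closed[OF closed_wedge])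

lemma cone_subset_wedge: "simplicial_cone \<subseteq> wedge i"
  by (auto simp: simplicial_cone_def wedge_def)

lemma interior_cone: "interior simplicial_cone \<noteq> {}"
proof -
  let ?U = "\<Inter>i\<in>I. {x. 0 < b i \<bullet> x}"
  have "b i \<bullet> (\<Sum>j\<in>I. a j) = 1" if "i \<in> I" for i
    using that fin dual by (simp add: inner_sum_right)
  then have "(\<Sum>j\<in>I. a j) \<in> ?U"
    by auto
  moreover have "open ?U"
    using fin by (intro open_INT ballI open_Collect_less continuous_intros)
  moreover have "?U \<subseteq> simplicial_cone"
    by (auto simp: simplicial_cone_def less_imp_le)
  ultimately show ?thesis
    using interior_maximal by blast
qed

lemma interior_wedge: "interior (wedge i) \<noteq> {}"
  using interior_cone interior_mono[OF cone_subset_wedge] by blast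

lemma cone_pos: "0 < measure gauss_measure simplicial_cone"
proof -
  have "0 < measure gauss_measure (interior simplicial_cone)"
    by (rule gauss_open_pos) (simp_all add: interior_cone)
  also have "\<dots> \<le> measure gauss_measure simplicial_cone"
    by (intro gauss.finite_measure_mono interior_subset) simp
  finally show ?thesis .
qed

lemma a_apex: "i \<in> I \<Longrightarrow> a i \<bullet> apex = 1"
  using fin dual by (simp add: apex_def inner_sum_right inner_commute[of "a i"] cong: if_cong)

text \<open>Compare the squared length of the apex with that of the multiple k W of the first moment W
  of the cone, where k is chosen so that k W equals the apex if the generators are orthonormal. In the
  bound |apex|^2 \<ge> 2 k (apex \<bullet> W) - k^2 |W|^2 both terms split into sums over the
  generators, because the first moment satisfies apex \<bullet> W = \<Sum> A i and |W|^2 = \<Sum> A i S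
  i.\<close>

theorem cone_inequality:
  assumes unit: "\<And>i. i \<in> I \<Longrightarrow> norm (a i) = 1"
  shows "real CARD('n) * (1 + pi / 2) * measure gauss_measure simplicial_cone
      \<le> measure gauss_measure simplicial_cone * (norm apex)\<^sup>2
          + pi / 4 * (\<Sum>i\<in>I. measure gauss_measure (wedge i))"
    and "real CARD('n) * (1 + pi / 2) * measure gauss_measure simplicial_cone
      = measure gauss_measure simplicial_cone * (norm apex)\<^sup>2 + pi / 4 * (\<Sum>i\<in>I. measure gauss_measure (wedge i))
      \<Longrightarrow> i \<in> I \<Longrightarrow> a i = b i"
proof -
  let ?P = "measure gauss_measure simplicial_cone"
  let ?\<theta> = "\<lambda>i. measure gauss_measure (wedge i)"
  define A where "A i = (\<integral>x. (b i \<bullet> x) * indicator simplicial_cone x \<partial>gauss_measure)" for i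
  define S where "S i = (\<integral>x. (a i \<bullet> x) * indicator simplicial_cone x \<partial>gauss_measure)" for i
  define W where "W = (\<Sum>i\<in>I. A i *\<^sub>R a i)"
  have int: "integrable gauss_measure (\<lambda>x. (y \<bullet> x) * indicator simplicial_cone x)" for y
    by (auto intro!: integrable_real_mult_indicator integrable_gauss_inner)
  have S: "S j = a j \<bullet> W" for j
  proof -
    have "S j = (\<integral>x. (\<Sum>i\<in>I. (a j \<bullet> a i) * ((b i \<bullet> x) * indicator simplicial_cone x)) \<partial>gauss_measure)"
      unfolding S_def
    proof (rule Bochner_Integration.integral_cong[OF refl])
      fix x
      have "a j \<bullet> x = a j \<bullet> (\<Sum>i\<in>I. (b i \<bullet> x) *\<^sub>R a i)"
        using expand[of x] by simp
      then show "(a j \<bullet> x) * indicator simplicial_cone x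
          = (\<Sum>i\<in>I. (a j \<bullet> a i) * ((b i \<bullet> x) * indicator simplicial_cone x))"
        by (simp add: inner_sum_right sum_distrib_left sum_distrib_right ac_simps)
    qed
    also have "\<dots> = (\<Sum>i\<in>I. (a j \<bullet> a i) * A i)"
      unfolding A_def by (subst Bochner_Integration.integral_sum) (auto intro: int)
    finally show ?thesis
      by (simp add: W_def inner_sum_right mult.commute)
  qed
  have P: "0 < ?P" by (rule cone_pos)
  define r where "r i = sqrt (2 * pi) * A i / ?P - pi / 2 * (A i * S i) / ?P\<^sup>2 + pi / 4 * ?\<theta> i / ?P" for i
  have local_term: "1 + pi / 2 \<le> r i" "1 + pi / 2 = r i \<Longrightarrow> a i = b i" if i: "i \<in> I" for i
  proof -
    interpret gauss_half_cylinder "a i" "b i" "wedge i"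
    proof
      show "norm (a i) = 1" "b i \<bullet> a i = 1"
        using unit dual i by auto
      show "convex (wedge i)"
        unfolding wedge_def Collect_ball_eq
        by (intro convex_INT convex_halfspace_ge)
      show "x + s *\<^sub>R a i \<in> wedge i" if "x \<in> wedge i" for x s
        using that i dual by (auto simp: wedge_def inner_simps)
    qed simp
    have C0: "half_cylinder 0 = simplicial_cone"
      using i unfolding half_cylinder_def by (auto simp: simplicial_cone_def wedge_def)
    have le: "?P \<le> ?\<theta> i"
      by (intro gauss.finite_measure_mono cone_subset_wedge) simp
    note facts = P le moment_b_nonneg[unfolded C0, folded A_def] moment_a_le[unfolded C0, folded S_def]
      moment_b_ge[unfolded C0, folded A_def] moment_product_le[unfolded C0, folded A_def S_def]
    show "1 + pi / 2 \<le> r i"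
      unfolding r_def by (rule cone_term_ge(1)[OF facts])
    show "a i = b i" if "1 + pi / 2 = r i"
      using moment_a_eq[unfolded C0, folded S_def] cone_term_ge(2)[OF facts] that interior_wedge
      unfolding r_def by blast
  qed
  \<comment> \<open>For orthonormal generators W is P sqrt (2 / \<pi>) times the apex, which determines k.\<close>
  define k where "k = sqrt (2 * pi) / (2 * ?P)"
  have k2: "k * k = pi / 2 / ?P\<^sup>2"
    using P by (simp add: k_def power2_eq_square field_simps)
  have vW: "apex \<bullet> W = (\<Sum>i\<in>I. A i)"
    using a_apex by (simp add: W_def inner_sum_right inner_commute[of apex])
  have WW: "W \<bullet> W = (\<Sum>i\<in>I. A i * S i)"
    by (subst (1) W_def) (simp add: inner_sum_left S)
  have "0 \<le> (apex - k *\<^sub>R W) \<bullet> (apex - k *\<^sub>R W)"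
    by simp
  also have "\<dots> = (norm apex)\<^sup>2 - 2 * k * (apex \<bullet> W) + k * k * (W \<bullet> W)"
    unfolding power2_norm_eq_inner by (simp add: inner_simps inner_commute[of W apex] algebra_simps)
  also have "\<dots> = (norm apex)\<^sup>2 - (\<Sum>i\<in>I. sqrt (2 * pi) * A i / ?P - pi / 2 * (A i * S i) / ?P\<^sup>2)"
    unfolding vW WW k2 sum_subtractf by (simp add: k_def sum_distrib_left sum_divide_distrib)
  finally have v: "(\<Sum>i\<in>I. sqrt (2 * pi) * A i / ?P - pi / 2 * (A i * S i) / ?P\<^sup>2) \<le> (norm apex)\<^sup>2"
    by simp
  have sum_r: "(\<Sum>i\<in>I. r i) \<le> (norm apex)\<^sup>2 + pi / 4 * (\<Sum>i\<in>I. ?\<theta> i) / ?P"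
  proof -
    have "(\<Sum>i\<in>I. r i)
        = (\<Sum>i\<in>I. sqrt (2 * pi) * A i / ?P - pi / 2 * (A i * S i) / ?P\<^sup>2) + (\<Sum>i\<in>I. pi / 4 * ?\<theta> i / ?P)"
      unfolding r_def by (rule sum.distrib)
    also have "(\<Sum>i\<in>I. pi / 4 * ?\<theta> i / ?P) = pi / 4 * (\<Sum>i\<in>I. ?\<theta> i) / ?P"
      by (simp add: sum_distrib_left sum_divide_distrib)
    finally show ?thesis using v by simp
  qed
  have const: "(\<Sum>i\<in>I. 1 + pi / 2) = real CARD('n) * (1 + pi / 2)"
    by (simp add: card_I)
  have le: "(\<Sum>i\<in>I. 1 + pi / 2) \<le> (\<Sum>i\<in>I. r i)"
    by (rule sum_mono) (rule local_term)
  have scale: "((norm apex)\<^sup>2 + pi / 4 * (\<Sum>i\<in>I. ?\<theta> i) / ?P) * ?P = ?P * (norm apex)\<^sup>2 + pi / 4 * (\<Sum>i\<in>I. ?\<theta> i)"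
    using P by (simp add: field_simps)
  have "real CARD('n) * (1 + pi / 2) \<le> (norm apex)\<^sup>2 + pi / 4 * (\<Sum>i\<in>I. ?\<theta> i) / ?P"
    using le sum_r const by linarith
  from mult_right_mono[OF this, of ?P] show "real CARD('n) * (1 + pi / 2) * ?P
      \<le> ?P * (norm apex)\<^sup>2 + pi / 4 * (\<Sum>i\<in>I. ?\<theta> i)"
    unfolding scale by simp
  show "a i = b i" if eq: "real CARD('n) * (1 + pi / 2) * ?P
      = ?P * (norm apex)\<^sup>2 + pi / 4 * (\<Sum>i\<in>I. ?\<theta> i)" and i: "i \<in> I" for i
  proof -
    have "real CARD('n) * (1 + pi / 2) = (norm apex)\<^sup>2 + pi / 4 * (\<Sum>i\<in>I. ?\<theta> i) / ?P"
      using eq P by (simp add: field_simps)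
    then have "(\<Sum>i\<in>I. r i) \<le> (\<Sum>i\<in>I. 1 + pi / 2)"
      using sum_r const by linarith
    then have "(\<Sum>i\<in>I. r i - (1 + pi / 2)) = 0"
      using le by (simp add: sum_subtractf)
    then have "r i - (1 + pi / 2) = 0"
      using local_term(1) i fin by (subst (asm) sum_nonneg_eq_0_iff) auto
    then show ?thesis
      using local_term(2)[OF i] by simp
  qed
qed

end

section \<open>A simplicial refinement of the normal fan\<close>

lemma dual_bases_exists:
  fixes a :: "'i \<Rightarrow> real ^ 'n"
  assumes inj: "inj_on a I" and ind: "independent (a ` I)" and span: "span (a ` I) = UNIV"
  obtains b where "dual_bases I a b"
proof -
  let ?r = "representation (a ` I)"
  define b where "b i = (\<Sum>e\<in>Basis. ?r e (a i) *\<^sub>R e)" for i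
  have lin: "linear (\<lambda>x. ?r x v)" for v
    using ind span by (intro linearI) (simp_all add: representation_add representation_scale)
  have b: "b i \<bullet> x = ?r x (a i)" for i x
  proof -
    have "?r x (a i) = ?r (\<Sum>e\<in>Basis. (x \<bullet> e) *\<^sub>R e) (a i)"
      by (simp add: euclidean_representation)
    also have "\<dots> = (\<Sum>e\<in>Basis. (x \<bullet> e) * ?r e (a i))"
      by (subst linear_sum[OF lin]) (simp add: linear_scale[OF lin])
    finally show ?thesis
      by (simp add: b_def inner_commute[of _ x] inner_sum_right mult.commute)
  qed
  have fin: "finite (a ` I)"
    using ind by (rule independent_imp_finite)
  have "dual_bases I a b"
  proof
    show "finite I"
      using finite_imageD[OF fin inj] .
    show "b i \<bullet> a j = (if i = j then 1 else 0)" if "i \<in> I" "j \<in> I" for i j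
      using that inj by (auto simp: b representation_basis[OF ind] inj_on_def)
    fix x
    have "x = (\<Sum>v\<in>a ` I. ?r x v *\<^sub>R v)"
      using sum_representation_eq[OF ind _ fin order_refl, of x] span by simp
    then show "x = (\<Sum>i\<in>I. (b i \<bullet> x) *\<^sub>R a i)"
      by (simp add: b sum.reindex[OF inj])
  qed
  then show ?thesis by (rule that)
qed

lemma (in dual_bases) eq_if_inner_eq:
  assumes "\<And>i. i \<in> I \<Longrightarrow> a i \<bullet> x = a i \<bullet> y"
  shows "x = y"
proof -
  have "(x - y) \<bullet> (x - y) = (\<Sum>i\<in>I. (b i \<bullet> (x - y)) *\<^sub>R a i) \<bullet> (x - y)"
    using expand[of "x - y"] by simp
  also have "\<dots> = 0"
    using assms by (simp add: inner_sum_left inner_diff_right)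
  finally show ?thesis by simp
qed

lemma eventually_at_right_witness: "\<forall>\<^sub>F e in at_right (x :: real). Q e \<Longrightarrow> \<exists>e. Q e"
  using eventually_happens'[OF trivial_limit_at_right_real] .

text \<open>The maximizers form a compact face, and an extreme point of a face is an extreme point of
  the whole set.\<close>

lemma linear_max_at_extreme_point:
  fixes S :: "'a::euclidean_space set"
  assumes "compact S" "convex S" "S \<noteq> {}"
  obtains v where "v extreme_point_of S" "\<And>y. y \<in> S \<Longrightarrow> x \<bullet> y \<le> x \<bullet> v"
proof -
  have "continuous_on S (\<lambda>y. x \<bullet> y)"
    by (intro continuous_intros)
  then obtain w where w: "w \<in> S" "\<And>y. y \<in> S \<Longrightarrow> x \<bullet> y \<le> x \<bullet> w"
    using continuous_attains_sup[OF assms(1,3)] by blast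
  let ?F = "S \<inter> {y. x \<bullet> y = x \<bullet> w}"
  have face: "?F face_of S"
    using w(2) by (intro face_of_Int_supporting_hyperplane_le assms)
  have "compact ?F"
    by (intro compact_Int_closed assms closed_hyperplane)
  then obtain v where "v extreme_point_of ?F"
    using extreme_point_exists_convex[of ?F] face_of_imp_convex[OF face] w(1) by blast
  then have "v extreme_point_of S" "x \<bullet> v = x \<bullet> w"
    using extreme_point_of_face[OF face] by auto
  then show ?thesis
    using that w(2) by auto
qed

lemma sum_measure_le_if_overlaps_null:
  fixes F :: "'i \<Rightarrow> (real ^ 'n) set"
  assumes "finite T" "\<And>i. i \<in> T \<Longrightarrow> F i \<in> sets borel" "\<Union>(F ` T) \<subseteq> S" "S \<in> sets borel"
    and null: "\<And>i j. i \<in> T \<Longrightarrow> j \<in> T \<Longrightarrow> i \<noteq> j \<Longrightarrow> measure gauss_measure (F i \<inter> F j) = 0"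
  shows "(\<Sum>i\<in>T. measure gauss_measure (F i)) \<le> measure gauss_measure S"
proof -
  have "(\<Sum>i\<in>T. measure gauss_measure (F i)) = measure gauss_measure (\<Union>(F ` T))"
    using assms(1,2) null
  proof (induction T rule: finite_induct)
    case (insert i T)
    let ?U = "\<Union>(F ` T)"
    have [measurable]: "?U \<in> sets borel" "F i \<in> sets borel"
      using insert.hyps insert.prems by auto
    have "measure gauss_measure (F i \<inter> ?U) \<le> (\<Sum>j\<in>T. measure gauss_measure (F i \<inter> F j))"
      using insert.hyps insert.prems
      by (subst Int_UN_distrib) (intro gauss.finite_measure_subadditive_finite, auto)
    also have "\<dots> = 0"
      using insert.hyps insert.prems by (intro sum.neutral) auto
    finally have "measure gauss_measure (F i \<inter> ?U) = 0"
      using measure_nonneg[of gauss_measure "F i \<inter> ?U"] by simp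
    then have "measure gauss_measure (F i \<union> ?U) = measure gauss_measure (F i) + measure gauss_measure ?U"
      using gauss.finite_measure_Diff'[of "F i" ?U] gauss.finite_measure_Union'[of ?U "F i"]
      by (simp add: Un_commute)
    then show ?case
      using insert by simp
  qed simp
  also have "\<dots> \<le> measure gauss_measure S"
    using assms by (intro gauss.finite_measure_mono) auto
  finally show ?thesis .
qed

text \<open>The unit right-hand sides are perturbed to heights c, which makes the polytope simple if c
  is generic; for c close to 1, the normal fan of the perturbed polytope refines the one for unit
  heights into simplicial cones.\<close>

locale tangential_polytope =
  fixes a :: "nat \<Rightarrow> real ^ 'n" and K :: "nat set"
  assumes finK: "finite K" and unit: "i \<in> K \<Longrightarrow> norm (a i) = 1"
    and bounded: "bounded {x. \<forall>i\<in>K. a i \<bullet> x \<le> 1}"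
begin

definition poly_at :: "(nat \<Rightarrow> real) \<Rightarrow> (real ^ 'n) set" where
  "poly_at c = {x. \<forall>i\<in>K. a i \<bullet> x \<le> c i}"

definition bases :: "nat set set" where
  "bases = {I. I \<subseteq> K \<and> (\<exists>b. dual_bases I a b)}"

text \<open>Uniquely determined on I for I in bases, arbitrary otherwise.\<close>

definition dual_vec :: "nat set \<Rightarrow> nat \<Rightarrow> real ^ 'n" where
  "dual_vec I = (SOME b. dual_bases I a b)"

text \<open>The point where the constraints in I are active for the heights c.\<close>

definition vertex_of :: "(nat \<Rightarrow> real) \<Rightarrow> nat set \<Rightarrow> real ^ 'n" where
  "vertex_of c I = (\<Sum>i\<in>I. c i *\<^sub>R dual_vec I i)"

definition generic :: "(nat \<Rightarrow> real) \<Rightarrow> bool" where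
  "generic c \<longleftrightarrow> (\<forall>I\<in>bases. \<forall>j\<in>K - I. a j \<bullet> vertex_of c I \<noteq> c j)"

text \<open>The index sets I whose cones make up the normal fan for heights c, provided that c is
  generic.\<close>

definition cells :: "(nat \<Rightarrow> real) \<Rightarrow> nat set set" where
  "cells c = {I \<in> bases. vertex_of c I \<in> poly_at c}"

abbreviation cell_cone :: "nat set \<Rightarrow> (real ^ 'n) set" where
  "cell_cone I \<equiv> dual_bases.simplicial_cone I (dual_vec I)"

abbreviation cell_wedge :: "nat set \<Rightarrow> nat \<Rightarrow> (real ^ 'n) set" where
  "cell_wedge I \<equiv> dual_bases.wedge I (dual_vec I)"

lemma dual_bases_dual_vec: "I \<in> bases \<Longrightarrow> dual_bases I a (dual_vec I)"
  unfolding bases_def dual_vec_def by (auto dest: someI_ex[of "dual_bases I a", OF exI])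

lemma finite_cells: "finite (cells c)"
  by (rule finite_subset[of _ "Pow K"]) (auto simp: cells_def bases_def finK)

lemma a_vertex_of:
  assumes "I \<in> bases" "i \<in> I"
  shows "a i \<bullet> vertex_of c I = c i"
proof -
  interpret dual_bases I a "dual_vec I" using assms(1) by (rule dual_bases_dual_vec)
  have "a i \<bullet> vertex_of c I = (\<Sum>j\<in>I. c j * (dual_vec I j \<bullet> a i))"
    by (simp add: vertex_of_def inner_sum_right inner_commute)
  also have "\<dots> = (\<Sum>j\<in>I. if j = i then c j else 0)"
    using dual assms(2) by (intro sum.cong) auto
  finally show ?thesis
    using assms(2) fin by simp
qed

lemma vertex_of_eqI:
  assumes "I \<in> bases" "\<And>i. i \<in> I \<Longrightarrow> a i \<bullet> v = c i"
  shows "vertex_of c I = v"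
  using dual_bases.eq_if_inner_eq[OF dual_bases_dual_vec[OF assms(1)], of "vertex_of c I" v] assms
      a_vertex_of by simp

lemma apex_eq: "I \<in> bases \<Longrightarrow> dual_bases.apex I (dual_vec I) = vertex_of (\<lambda>_. 1) I"
  by (simp add: dual_bases.apex_def[OF dual_bases_dual_vec] vertex_of_def)

text \<open>Constraints that are active at v must not increase in direction y; the inactive ones leave
  room for a short step.\<close>

lemma small_step:
  assumes "v \<in> poly_at c" and "\<And>i. i \<in> K \<Longrightarrow> a i \<bullet> v = c i \<Longrightarrow> a i \<bullet> y \<le> 0"
  shows "\<forall>\<^sub>F \<delta> in at_right 0. v + \<delta> *\<^sub>R y \<in> poly_at c"
proof -
  have "\<forall>\<^sub>F \<delta> in at_right 0. a i \<bullet> (v + \<delta> *\<^sub>R y) \<le> c i" if i: "i \<in> K" for i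
  proof (cases "a i \<bullet> v = c i")
    case True
    show ?thesis
      using eventually_at_right_less[of "0 :: real"]
    proof eventually_elim
      case (elim \<delta>)
      then show ?case
        using assms(2)[OF i True] True by (simp add: inner_simps mult_nonneg_nonpos)
    qed
  next
    case False
    then have "a i \<bullet> (v + 0 *\<^sub>R y) < c i"
      using assms(1) i by (auto simp: poly_at_def less_le)
    moreover have "((\<lambda>\<delta>. a i \<bullet> (v + \<delta> *\<^sub>R y)) \<longlongrightarrow> a i \<bullet> (v + 0 *\<^sub>R y)) (at_right 0)"
      by (intro tendsto_intros)
    ultimately have "\<forall>\<^sub>F \<delta> in at_right 0. a i \<bullet> (v + \<delta> *\<^sub>R y) < c i"
      by (metis order_tendstoD(2))
    then show ?thesis
      by (rule eventually_mono) simp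
  qed
  then have "\<forall>\<^sub>F \<delta> in at_right 0. \<forall>i\<in>K. a i \<bullet> (v + \<delta> *\<^sub>R y) \<le> c i"
    using finK by (simp add: eventually_ball_finite_distrib)
  then show ?thesis
    by (simp add: poly_at_def)
qed

lemma extreme_if_active_span:
  assumes v: "v \<in> poly_at c" and act: "A \<subseteq> K" "\<And>i. i \<in> A \<Longrightarrow> a i \<bullet> v = c i"
    and span: "\<And>y. (\<And>i. i \<in> A \<Longrightarrow> a i \<bullet> y = 0) \<Longrightarrow> y = 0"
  shows "v extreme_point_of (poly_at c)"
  unfolding extreme_point_of_def
proof (intro conjI v ballI notI)
  fix p q assume p: "p \<in> poly_at c" and q: "q \<in> poly_at c" and "v \<in> open_segment p q"
  then obtain u where u: "0 < u" "u < 1" "v = (1 - u) *\<^sub>R p + u *\<^sub>R q" and pq: "p \<noteq> q"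
    by (auto simp: in_segment)
  have "a i \<bullet> (p - q) = 0" if i: "i \<in> A" for i
  proof -
    have le: "a i \<bullet> p \<le> c i" "a i \<bullet> q \<le> c i"
      using p q i act(1) by (auto simp: poly_at_def)
    have "(1 - u) * (c i - a i \<bullet> p) + u * (c i - a i \<bullet> q) = 0"
      using act(2)[OF i] by (simp add: u(3) inner_simps algebra_simps)
    then have "(1 - u) * (c i - a i \<bullet> p) = 0" "u * (c i - a i \<bullet> q) = 0"
      using le u by (simp_all add: add_nonneg_eq_0_iff)
    then show ?thesis
      using u by (simp add: inner_simps)
  qed
  then have "p - q = 0" by (rule span)
  then show False using pq by simp
qed

text \<open>If the active normals did not span the space, one could move from v in both directions
  orthogonal to them.\<close>

lemma extreme_active_basis:
  assumes v: "v extreme_point_of (poly_at c)"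
  obtains I where "I \<in> bases" "\<And>i. i \<in> I \<Longrightarrow> a i \<bullet> v = c i"
proof -
  define A where "A = {i \<in> K. a i \<bullet> v = c i}"
  have vP: "v \<in> poly_at c" using v by (simp add: extreme_point_of_def)
  have "span (a ` A) = UNIV"
  proof (rule ccontr)
    assume "span (a ` A) \<noteq> UNIV"
    then obtain y where y: "y \<noteq> 0" "\<And>x. x \<in> span (a ` A) \<Longrightarrow> y \<bullet> x = 0"
      using span_not_UNIV_orthogonal by blast
    have ay: "a i \<bullet> y = 0" if "i \<in> K" "a i \<bullet> v = c i" for i
      using y(2)[of "a i"] that by (simp add: A_def span_base inner_commute)
    have "\<forall>\<^sub>F \<delta> in at_right 0. v + \<delta> *\<^sub>R y \<in> poly_at c \<and> v + \<delta> *\<^sub>R (- y) \<in> poly_at c \<and> 0 < \<delta>"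
      using ay by (intro eventually_conj small_step vP eventually_at_right_less) (auto simp: inner_simps)
    then obtain \<delta> where \<delta>: "v + \<delta> *\<^sub>R y \<in> poly_at c" "v + \<delta> *\<^sub>R (- y) \<in> poly_at c" "0 < \<delta>"
      using eventually_at_right_witness by blast
    have "v = midpoint (v + \<delta> *\<^sub>R y) (v + \<delta> *\<^sub>R (- y))"
      by (simp add: midpoint_def algebra_simps scaleR_2[symmetric])
    moreover have "v + \<delta> *\<^sub>R y \<noteq> v + \<delta> *\<^sub>R (- y)"
    proof
      assume "v + \<delta> *\<^sub>R y = v + \<delta> *\<^sub>R (- y)"
      then have "(2 * \<delta>) *\<^sub>R y = 0"
        by (simp add: algebra_simps scaleR_2[symmetric] eq_neg_iff_add_eq_0)
      then show False using y \<delta> by simp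
    qed
    ultimately have "v \<in> open_segment (v + \<delta> *\<^sub>R y) (v + \<delta> *\<^sub>R (- y))"
      using midpoint_in_open_segment by metis
    then show False
      using v \<delta> by (simp add: extreme_point_of_def)
  qed
  moreover obtain B where B: "B \<subseteq> a ` A" "independent B" "a ` A \<subseteq> span B"
    using maximal_independent_subset by blast
  moreover obtain I where I: "I \<subseteq> A" "inj_on a I" "B = a ` I"
    using B(1) subset_image_inj by metis
  ultimately have "span (a ` I) = UNIV"
    using span_minimal[OF B(3) subspace_span] by auto
  then obtain b where "dual_bases I a b"
    using dual_bases_exists[OF I(2)] B I by metis
  then have "I \<in> bases"
    using I by (auto simp: bases_def A_def)
  moreover have "a i \<bullet> v = c i" if "i \<in> I" for i
    using that I by (auto simp: A_def)
  ultimately show ?thesis by (rule that)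
qed

lemma extreme_cell:
  assumes "v extreme_point_of (poly_at c)"
  obtains I where "I \<in> cells c" "v = vertex_of c I"
proof -
  obtain I where I: "I \<in> bases" "\<And>i. i \<in> I \<Longrightarrow> a i \<bullet> v = c i"
    using extreme_active_basis[OF assms] by blast
  then have "v = vertex_of c I"
    using vertex_of_eqI by metis
  then show ?thesis
    using that I assms by (auto simp: cells_def extreme_point_of_def)
qed

lemma generic_active:
  assumes "generic c" "I \<in> cells c" "j \<in> K" "a j \<bullet> vertex_of c I = c j"
  shows "j \<in> I"
  using assms by (auto simp: generic_def cells_def)

lemma convex_poly_at: "convex (poly_at c)"
  unfolding poly_at_def Collect_ball_eq by (intro convex_INT convex_halfspace_le)

lemma closed_poly_at: "closed (poly_at c)"
  unfolding poly_at_def Collect_ball_eq by (auto intro!: closed_INT closed_Collect_le continuous_intros)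

lemma compact_poly_at:
  assumes "\<And>i. i \<in> K \<Longrightarrow> c i \<le> 2"
  shows "compact (poly_at c)"
proof -
  have "poly_at c \<subseteq> (\<lambda>x. 2 *\<^sub>R x) ` {x. \<forall>i\<in>K. a i \<bullet> x \<le> 1}"
  proof
    fix x assume "x \<in> poly_at c"
    then have "\<forall>i\<in>K. a i \<bullet> x \<le> 2"
      using assms by (force simp: poly_at_def)
    then have "(1 / 2) *\<^sub>R x \<in> {x. \<forall>i\<in>K. a i \<bullet> x \<le> 1}"
      by simp
    moreover have "x = 2 *\<^sub>R ((1 / 2) *\<^sub>R x)"
      by simp
    ultimately show "x \<in> (\<lambda>x. 2 *\<^sub>R x) ` {x. \<forall>i\<in>K. a i \<bullet> x \<le> 1}"
      by (rule rev_image_eqI)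
  qed
  then have "bounded (poly_at c)"
    using bounded bounded_scaling bounded_subset by blast
  then show ?thesis
    using closed_poly_at by (simp add: compact_eq_bounded_closed)
qed

lemma cell_cone_max:
  assumes "I \<in> bases" "x \<in> cell_cone I" "y \<in> poly_at c"
  shows "x \<bullet> y \<le> x \<bullet> vertex_of c I"
proof -
  interpret dual_bases I a "dual_vec I" using assms(1) by (rule dual_bases_dual_vec)
  have IK: "I \<subseteq> K" using assms(1) by (simp add: bases_def)
  have *: "x \<bullet> z = (\<Sum>i\<in>I. (dual_vec I i \<bullet> x) * (a i \<bullet> z))" for z
  proof -
    have "x \<bullet> z = (\<Sum>i\<in>I. (dual_vec I i \<bullet> x) *\<^sub>R a i) \<bullet> z"
      using expand[of x] by simp
    then show ?thesis by (simp add: inner_sum_left)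
  qed
  show ?thesis
    unfolding *
  proof (rule sum_mono)
    fix i assume i: "i \<in> I"
    then have "0 \<le> dual_vec I i \<bullet> x" "a i \<bullet> y \<le> c i"
      using assms IK by (auto simp: simplicial_cone_def poly_at_def)
    then show "(dual_vec I i \<bullet> x) * (a i \<bullet> y) \<le> (dual_vec I i \<bullet> x) * (a i \<bullet> vertex_of c I)"
      using a_vertex_of[OF assms(1) i] by (simp add: mult_left_mono)
  qed
qed

text \<open>A vertex that maximizes x is the vertex of some cell I. By genericity only the constraints
  in I are active there, so one can move a little in each direction - b i dual to I; maximality then
  says b i \<bullet> x \<ge> 0.\<close>

lemma cells_cover:
  assumes gen: "generic c" and c: "\<And>i. i \<in> K \<Longrightarrow> 0 < c i \<and> c i \<le> 2"
  obtains I where "I \<in> cells c" "x \<in> cell_cone I"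
proof -
  have "0 \<in> poly_at c"
    using c by (auto simp: poly_at_def less_imp_le)
  then obtain v where v: "v extreme_point_of (poly_at c)" "\<And>y. y \<in> poly_at c \<Longrightarrow> x \<bullet> y \<le> x \<bullet> v"
    using linear_max_at_extreme_point[of "poly_at c" x] compact_poly_at convex_poly_at c by (metis empty_iff)
  obtain I where I: "I \<in> cells c" "v = vertex_of c I"
    using extreme_cell[OF v(1)] by blast
  then have bas: "I \<in> bases" by (simp add: cells_def)
  interpret dual_bases I a "dual_vec I" using bas by (rule dual_bases_dual_vec)
  have "0 \<le> dual_vec I i \<bullet> x" if i: "i \<in> I" for i
  proof -
    have "\<forall>\<^sub>F \<delta> in at_right 0. v + \<delta> *\<^sub>R (- dual_vec I i) \<in> poly_at c \<and> 0 < \<delta>"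
    proof (intro eventually_conj small_step eventually_at_right_less)
      show "v \<in> poly_at c" using v(1) by (simp add: extreme_point_of_def)
      fix j assume "j \<in> K" "a j \<bullet> v = c j"
      then have "j \<in> I"
        using generic_active[OF gen I(1)] I(2) by simp
      then show "a j \<bullet> - dual_vec I i \<le> 0"
        using dual[OF i] by (simp add: inner_commute)
    qed
    then obtain \<delta> where \<delta>: "v + \<delta> *\<^sub>R (- dual_vec I i) \<in> poly_at c" "0 < \<delta>"
      using eventually_at_right_witness by blast
    then have "x \<bullet> (v + \<delta> *\<^sub>R (- dual_vec I i)) \<le> x \<bullet> v"
      using v(2) by blast
    then show ?thesis
      using \<delta>(2) by (simp add: inner_simps inner_commute zero_le_mult_iff)
  qed
  then have "x \<in> cell_cone I"
    by (simp add: simplicial_cone_def)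
  then show ?thesis
    using that I by blast
qed

lemma cells_vertex_inj:
  assumes "generic c" "I \<in> cells c" "J \<in> cells c" "vertex_of c I = vertex_of c J"
  shows "I = J"
proof -
  have sub: "J' \<subseteq> I'" if "I' \<in> cells c" "J' \<in> cells c" "vertex_of c I' = vertex_of c J'" for I' J'
  proof
    fix j assume "j \<in> J'"
    then have "a j \<bullet> vertex_of c I' = c j" "j \<in> K"
      using that a_vertex_of[of J' j c] by (auto simp: cells_def bases_def)
    then show "j \<in> I'"
      using generic_active[OF assms(1) that(1)] by blast
  qed
  show ?thesis
    using sub[of I J] sub[of J I] assms by auto
qed

lemma cell_cone_overlap:
  assumes "I \<in> cells c" "J \<in> cells c" "x \<in> cell_cone I" "x \<in> cell_cone J"
  shows "(vertex_of c I - vertex_of c J) \<bullet> x = 0"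
  using cell_cone_max[of I x "vertex_of c J" c] cell_cone_max[of J x "vertex_of c I" c] assms
  by (simp add: cells_def inner_simps inner_commute)

text \<open>Adding a large multiple of a i moves a point of both wedges into both cones, and it does not
  change the product with the difference of the two vertices, since both satisfy a i \<bullet> v = c
  i.\<close>

lemma cell_wedge_overlap:
  assumes I: "I \<in> cells c" "i \<in> I" "x \<in> cell_wedge I i"
    and J: "J \<in> cells c" "i \<in> J" "x \<in> cell_wedge J i"
  shows "(vertex_of c I - vertex_of c J) \<bullet> x = 0"
proof -
  \<comment> \<open>Large enough to make the i-th coordinate nonnegative with respect to both bases.\<close>
  define r where "r = \<bar>dual_vec I i \<bullet> x\<bar> + \<bar>dual_vec J i \<bullet> x\<bar>"
  have "x + r *\<^sub>R a i \<in> cell_cone I'"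
      if I': "I' \<in> bases" "i \<in> I'" "x \<in> cell_wedge I' i" "\<bar>dual_vec I' i \<bullet> x\<bar> \<le> r" for I'
  proof -
    interpret dual_bases I' a "dual_vec I'" using I'(1) by (rule dual_bases_dual_vec)
    show ?thesis
      using I' dual by (auto simp: simplicial_cone_def wedge_def inner_simps)
  qed
  then have "(vertex_of c I - vertex_of c J) \<bullet> (x + r *\<^sub>R a i) = 0"
    using I J by (intro cell_cone_overlap) (auto simp: cells_def r_def)
  moreover have "(vertex_of c I - vertex_of c J) \<bullet> a i = 0"
    using I J a_vertex_of[of I i c] a_vertex_of[of J i c] by (simp add: cells_def inner_simps inner_commute)
  ultimately show ?thesis
    by (simp add: inner_simps)
qed

lemma cells_overlap_null:
  assumes "generic c" "I \<in> cells c" "J \<in> cells c" "I \<noteq> J"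
    and "\<And>x. x \<in> X \<Longrightarrow> (vertex_of c I - vertex_of c J) \<bullet> x = 0"
  shows "measure gauss_measure X = 0"
proof -
  have "vertex_of c I - vertex_of c J \<noteq> 0"
    using cells_vertex_inj[OF assms(1-3)] assms(4) by auto
  then have "measure gauss_measure {x. (vertex_of c I - vertex_of c J) \<bullet> x = 0} = 0"
    by (rule gauss_hyperplane_null)
  moreover have "measure gauss_measure X \<le> measure gauss_measure {x. (vertex_of c I - vertex_of c J) \<bullet> x = 0}"
    using assms(5) by (intro gauss.finite_measure_mono)
        (auto intro!: borel_closed closed_Collect_eq continuous_intros)
  ultimately show ?thesis
    using measure_nonneg[of gauss_measure X] by simp
qed

text \<open>For fixed I and j the failure of genericity is a polynomial equation in e, whose coefficient
  at e^(j+1) is 1 as j is not in I; so it has finitely many solutions.\<close>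

lemma generic_heights:
  "\<forall>\<^sub>F e in at_right 0. generic (\<lambda>i. 1 + e ^ Suc i)"
proof -
  have fin: "finite bases"
    by (rule finite_subset[of _ "Pow K"]) (auto simp: bases_def finK)
  have "\<forall>\<^sub>F e in at_right 0. a j \<bullet> vertex_of (\<lambda>i. 1 + e ^ Suc i) I \<noteq> 1 + e ^ Suc j"
    if I: "I \<in> bases" and j: "j \<in> K - I" for I j
  proof -
    define p where "p = [: (1 - (\<Sum>i\<in>I. a j \<bullet> dual_vec I i)) :] + monom 1 (Suc j)
        - (\<Sum>i\<in>I. monom (a j \<bullet> dual_vec I i) (Suc i))"
    have "coeff p (Suc j) = 1"
      using j by (auto simp: p_def coeff_sum coeff_pCons intro!: sum.neutral)
    then have "p \<noteq> 0" by auto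
    then have "finite {e. poly p e = 0}"
      by (rule poly_roots_finite)
    then have "\<forall>\<^sub>F e in at_right 0. \<forall>x\<in>{e. poly p e = 0}. e \<noteq> x"
      by (simp only: eventually_ball_finite_distrib eventually_neq_at_within) simp
    note avoid = this
    have eval: "poly p e = 1 + e ^ Suc j - a j \<bullet> vertex_of (\<lambda>i. 1 + e ^ Suc i) I" for e
      by (simp add: p_def vertex_of_def poly_sum poly_monom inner_sum_right algebra_simps sum.distrib)
    show ?thesis
    proof (rule eventually_mono[OF avoid])
      fix e assume "\<forall>x\<in>{e. poly p e = 0}. e \<noteq> x"
      then have "poly p e \<noteq> 0" by blast
      then show "a j \<bullet> vertex_of (\<lambda>i. 1 + e ^ Suc i) I \<noteq> 1 + e ^ Suc j"
        unfolding eval by simp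
    qed
  qed
  then have "\<forall>\<^sub>F e in at_right 0. \<forall>I\<in>bases. \<forall>j\<in>K - I. a j \<bullet> vertex_of (\<lambda>i. 1 + e ^ Suc i) I \<noteq> 1 + e ^ Suc j"
    using finK fin by (simp add: eventually_ball_finite_distrib)
  then show ?thesis
    by (simp add: generic_def)
qed

text \<open>A constraint violated at the vertex of I for unit heights stays violated for heights close
  to 1.\<close>

lemma cells_stable:
  "\<forall>\<^sub>F e in at_right 0. cells (\<lambda>i. 1 + e ^ Suc i) \<subseteq> cells (\<lambda>_. 1)"
proof -
  have fin: "finite bases"
    by (rule finite_subset[of _ "Pow K"]) (auto simp: bases_def finK)
  have "\<forall>\<^sub>F e in at_right 0. a j \<bullet> vertex_of (\<lambda>i. 1 + e ^ Suc i) I \<le> 1 + e ^ Suc j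
      \<longrightarrow> a j \<bullet> vertex_of (\<lambda>_. 1) I \<le> 1"
    if "I \<in> bases" "j \<in> K" for I j
  proof (cases "a j \<bullet> vertex_of (\<lambda>_. 1) I \<le> 1")
    case False
    have "((\<lambda>e. a j \<bullet> vertex_of (\<lambda>i. 1 + e ^ Suc i) I - (1 + e ^ Suc j)) \<longlongrightarrow>
        a j \<bullet> vertex_of (\<lambda>i. 1 + 0 ^ Suc i) I - (1 + 0 ^ Suc j)) (at_right 0)"
      unfolding vertex_of_def by (intro tendsto_intros)
    moreover have "0 < a j \<bullet> vertex_of (\<lambda>i. 1 + 0 ^ Suc i) I - (1 + 0 ^ Suc j)"
      using False by simp
    ultimately have "\<forall>\<^sub>F e in at_right 0. 0 < a j \<bullet> vertex_of (\<lambda>i. 1 + e ^ Suc i) I - (1 + e ^ Suc j)"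
      by (rule order_tendstoD(1))
    then show ?thesis
      by (rule eventually_mono) simp
  qed simp
  then have "\<forall>\<^sub>F e in at_right 0. \<forall>I\<in>bases. \<forall>j\<in>K.
      a j \<bullet> vertex_of (\<lambda>i. 1 + e ^ Suc i) I \<le> 1 + e ^ Suc j \<longrightarrow> a j \<bullet> vertex_of (\<lambda>_. 1) I \<le> 1"
    using finK fin by (simp add: eventually_ball_finite_distrib)
  then show ?thesis
    by (rule eventually_mono) (auto simp: cells_def poly_at_def)
qed

lemma exists_good_heights:
  obtains c where "generic c" "\<And>i. 0 < c i \<and> c i \<le> 2" "cells c \<subseteq> cells (\<lambda>_. 1)"
proof -
  have "\<forall>\<^sub>F e in at_right 0. (0 :: real) < e \<and> e < 1"
    by (rule eventually_at_rightI[of 0 1]) auto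
  then have "\<forall>\<^sub>F e in at_right 0. (generic (\<lambda>i. 1 + e ^ Suc i) \<and> cells (\<lambda>i. 1
      + e ^ Suc i) \<subseteq> cells (\<lambda>_. 1)) \<and> 0 < e \<and> e < 1"
    using generic_heights cells_stable by eventually_elim blast
  then obtain e where e: "generic (\<lambda>i. 1 + e ^ Suc i)" "cells (\<lambda>i. 1
      + e ^ Suc i) \<subseteq> cells (\<lambda>_. 1)" "0 < e" "e < 1"
    using eventually_at_right_witness by blast
  have "0 < 1 + e ^ Suc i \<and> 1 + e ^ Suc i \<le> 2" for i
    using e power_le_one[of e "Suc i"] by (simp add: add_pos_pos)
  then show ?thesis
    using that e by blast
qed

end

section \<open>Summation over the fan and the case of equality\<close>

lemma closed_normal_cone: "closed (normal_cone P v)"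
  unfolding normal_cone_def Collect_ball_eq by (auto intro!: closed_INT closed_Collect_le continuous_intros)

lemma prob_gauss_UNIV: "measure gauss_measure UNIV = 1"
  using gauss.prob_space by simp

lemma operator_trace_second_moment:
  "operator_trace (second_moment_operator P) = (\<Sum>v\<in>vert P. gauss_weight P v * (norm v)\<^sup>2)"
proof -
  have "operator_trace (second_moment_operator P)
      = (\<Sum>i\<in>UNIV. \<Sum>v\<in>vert P. gauss_weight P v * (v $ i * v $ i))"
    by (simp add: operator_trace_def trace_def matrix_def second_moment_operator_def
        tensor_square_def inner_axis mult.assoc)
  also have "\<dots> = (\<Sum>v\<in>vert P. gauss_weight P v * (v \<bullet> v))"
    by (subst sum.swap) (simp add: inner_vec_def sum_distrib_left)
  finally show ?thesis
    by (simp add: power2_norm_eq_inner)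
qed

text \<open>A common normal vector of two vertices is orthogonal to their difference.\<close>

lemma sum_gauss_weight_le_1:
  assumes "finite (vert P)"
  shows "(\<Sum>v\<in>vert P. gauss_weight P v) \<le> 1"
proof -
  have "(\<Sum>v\<in>vert P. measure gauss_measure (normal_cone P v)) \<le> measure gauss_measure (UNIV :: (real ^ 'a) set)"
  proof (rule sum_measure_le_if_overlaps_null[OF assms])
    fix v w assume vw: "v \<in> vert P" "w \<in> vert P" "v \<noteq> w"
    have "normal_cone P v \<inter> normal_cone P w \<subseteq> {x. (v - w) \<bullet> x = 0}"
    proof
      fix p assume "p \<in> normal_cone P v \<inter> normal_cone P w"
      then have "p \<bullet> (w - v) \<le> 0" "p \<bullet> (v - w) \<le> 0"
        using vw by (auto simp: normal_cone_def vert_def extreme_point_of_def)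
      then show "p \<in> {x. (v - w) \<bullet> x = 0}"
        by (simp add: inner_simps inner_commute)
    qed
    then have "measure gauss_measure (normal_cone P v \<inter> normal_cone P w)
        \<le> measure gauss_measure {x. (v - w) \<bullet> x = 0}"
      by (intro gauss.finite_measure_mono) (auto intro!: borel_closed closed_Collect_eq continuous_intros)
    then show "measure gauss_measure (normal_cone P v \<inter> normal_cone P w) = 0"
      using gauss_hyperplane_null[of "v
          - w"] vw(3) measure_nonneg[of gauss_measure "normal_cone P v \<inter> normal_cone P w"] by simp
  qed (auto intro: borel_closed closed_normal_cone)
  then show ?thesis
    by (simp add: gauss_weight_def prob_gauss_UNIV)
qed

text \<open>An extreme point of the cube has all coordinates \<plusminus> 1, since any other coordinate
  can be moved both ways.\<close>

lemma norm_vertex_rotated_cube: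
  fixes U :: "real ^ 'n \<Rightarrow> real ^ 'n"
  assumes U: "orthogonal_transformation U" and v: "v \<in> vert (U ` cbox (vec (- 1)) (vec 1))"
  shows "(norm v)\<^sup>2 = real CARD('n)"
proof -
  have lin: "linear U" and inj: "inj U"
    using U orthogonal_transformation_linear orthogonal_transformation_inj by blast+
  obtain w where w: "v = U w" "w \<in> cbox (vec (- 1)) (vec 1)"
    using v by (auto simp: vert_def extreme_point_of_def)
  have extreme: "w \<notin> open_segment p q" if "p \<in> cbox (vec (- 1)) (vec 1)" "q \<in> cbox (vec (- 1)) (vec 1)" for p q
    using v that w(1) open_segment_linear_image[OF lin inj, of p q]
    by (auto simp: vert_def extreme_point_of_def)
  have wc: "- 1 \<le> w $ i" "w $ i \<le> 1" for i
    using w(2) by (auto simp: mem_box_cart)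
  have "(w $ i)\<^sup>2 = 1" for i
  proof (rule ccontr)
    assume "(w $ i)\<^sup>2 \<noteq> 1"
    then have i: "- 1 < w $ i" "w $ i < 1"
      using wc[of i] by (auto simp: less_le power2_eq_1_iff)
    define \<delta> where "\<delta> = min (1 - w $ i) (1 + w $ i)"
    have \<delta>: "0 < \<delta>" "\<delta> \<le> 1 - w $ i" "\<delta> \<le> 1 + w $ i"
      using i by (auto simp: \<delta>_def)
    let ?p = "w + \<delta> *\<^sub>R axis i 1" and ?q = "w + (- \<delta>) *\<^sub>R axis i 1"
    have "?p \<in> cbox (vec (- 1)) (vec 1)" "?q \<in> cbox (vec (- 1)) (vec 1)"
      using wc \<delta> by (auto simp: mem_box_cart axis_def)
    moreover have "w \<in> open_segment ?p ?q"
    proof -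
      have "w = midpoint ?p ?q"
        by (simp add: midpoint_def algebra_simps scaleR_2[symmetric])
      moreover have "?p $ i \<noteq> ?q $ i"
        using \<delta> by simp
      ultimately show ?thesis
        using midpoint_in_open_segment[of ?p ?q] by metis
    qed
    ultimately show False
      using extreme by blast
  qed
  then have "w \<bullet> w = real CARD('n)"
    by (simp add: inner_vec_def power2_eq_square)
  moreover have "norm v = norm w"
    using U w(1) orthogonal_transformation_norm by blast
  ultimately show ?thesis
    by (simp add: power2_norm_eq_inner)
qed

lemma symmetric_frame_cube:
  fixes a :: "'i \<Rightarrow> real ^ 'n"
  assumes "dual_bases I a a"
  obtains U :: "real ^ 'n \<Rightarrow> real ^ 'n" where "orthogonal_transformation U"
    "{x. \<forall>i\<in>I. \<bar>a i \<bullet> x\<bar> \<le> 1} = U ` cbox (vec (- 1)) (vec 1)"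
proof -
  interpret dual_bases I a a by (rule assms)
  obtain \<beta> where \<beta>: "bij_betw \<beta> (UNIV :: 'n set) I"
    using finite_same_card_bij[of "UNIV :: 'n set" I] fin card_I by auto
  define U where "U y = (\<Sum>k\<in>UNIV. (y $ k) *\<^sub>R a (\<beta> k))" for y :: "real ^ 'n"
  have \<beta>I: "\<beta> k \<in> I" for k
    using \<beta> by (auto simp: bij_betw_def)
  have orth: "a (\<beta> k) \<bullet> a (\<beta> l) = (if k = l then 1 else 0)" for k l
    using dual[OF \<beta>I \<beta>I, of k l] \<beta> by (auto simp: bij_betw_def inj_on_def)
  have aU: "a (\<beta> k) \<bullet> U y = y $ k" for k y
    by (simp add: U_def inner_sum_right orth if_distrib cong: if_cong)
  have "orthogonal_transformation U"
    unfolding orthogonal_transformation_def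
  proof
    show "linear U"
      by (rule linearI) (simp_all add: U_def scaleR_add_left sum.distrib scaleR_sum_right)
    show "\<forall>v w. U v \<bullet> U w = v \<bullet> w"
    proof (intro allI)
      fix v w
      have "U v \<bullet> U w = (\<Sum>k\<in>UNIV. (v $ k) *\<^sub>R a (\<beta> k)) \<bullet> U w"
        by (simp add: U_def)
      also have "\<dots> = v \<bullet> w"
        unfolding inner_sum_left inner_scaleR_left aU by (simp add: inner_vec_def)
      finally show "U v \<bullet> U w = v \<bullet> w" .
    qed
  qed
  moreover have "{x. \<forall>i\<in>I. \<bar>a i \<bullet> x\<bar> \<le> 1} = U ` cbox (vec (- 1)) (vec 1)"
  proof (intro equalityI subsetI)
    fix x assume x: "x \<in> {x. \<forall>i\<in>I. \<bar>a i \<bullet> x\<bar> \<le> 1}"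
    define y :: "real ^ 'n" where "y = (\<chi> k. a (\<beta> k) \<bullet> x)"
    have "x = (\<Sum>i\<in>I. (a i \<bullet> x) *\<^sub>R a i)" by (rule expand)
    also have "\<dots> = U y"
      unfolding U_def y_def by (subst sum.reindex_bij_betw[OF \<beta>, symmetric]) simp
    finally have "x = U y" .
    moreover have "y \<in> cbox (vec (- 1)) (vec 1)"
      using x \<beta>I by (auto simp: mem_box_cart y_def abs_le_iff minus_le_iff)
    ultimately show "x \<in> U ` cbox (vec (- 1)) (vec 1)" by blast
  next
    fix x assume "x \<in> U ` cbox (vec (- 1)) (vec 1)"
    then obtain y where y: "x = U y" "\<And>k. - 1 \<le> y $ k \<and> y $ k \<le> 1"
      by (auto simp: mem_box_cart)
    show "x \<in> {x. \<forall>i\<in>I. \<bar>a i \<bullet> x\<bar> \<le> 1}"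
    proof (intro CollectI ballI)
      fix i assume "i \<in> I"
      then obtain k where "i = \<beta> k"
        using \<beta> by (auto simp: bij_betw_def)
      then show "\<bar>a i \<bullet> x\<bar> \<le> 1"
        using y(2)[of k] by (simp add: y(1) aU abs_le_iff minus_le_iff)
    qed
  qed
  ultimately show ?thesis by (rule that)
qed

context tangential_polytope
begin

abbreviation body :: "(real ^ 'n) set" where
  "body \<equiv> poly_at (\<lambda>_. 1)"

lemma finite_vert_body: "finite (vert body)"
proof (rule finite_subset)
  show "vert body \<subseteq> vertex_of (\<lambda>_. 1) ` cells (\<lambda>_. 1)"
    unfolding vert_def using extreme_cell by blast
qed (simp add: finite_cells)

lemma vertex_of_in_vert:
  assumes "I \<in> cells (\<lambda>_. 1)"
  shows "vertex_of (\<lambda>_. 1) I \<in> vert body"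
proof -
  have bas: "I \<in> bases" and IK: "I \<subseteq> K"
    using assms by (auto simp: cells_def bases_def)
  interpret dual_bases I a "dual_vec I" using bas by (rule dual_bases_dual_vec)
  have "vertex_of (\<lambda>_. 1) I extreme_point_of body"
  proof (rule extreme_if_active_span[of _ _ I])
    show "y = 0" if "\<And>i. i \<in> I \<Longrightarrow> a i \<bullet> y = 0" for y
      using eq_if_inner_eq[of y 0] that by simp
  qed (use assms IK a_vertex_of[OF bas] in \<open>auto simp: cells_def\<close>)
  then show ?thesis by (simp add: vert_def)
qed

lemma cell_cone_subset_normal_cone:
  assumes "I \<in> bases"
  shows "cell_cone I \<subseteq> normal_cone body (vertex_of (\<lambda>_. 1) I)"
  using cell_cone_max[OF assms, of _ _ "\<lambda>_. 1"] by (auto simp: normal_cone_def inner_simps)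

lemma cell_cone_meas: "I \<in> bases \<Longrightarrow> cell_cone I \<in> sets borel"
  and cell_wedge_meas: "I \<in> bases \<Longrightarrow> cell_wedge I i \<in> sets borel"
  by (rule dual_bases.cone_meas[OF dual_bases_dual_vec], assumption,
      rule dual_bases.wedge_meas[OF dual_bases_dual_vec], assumption)

lemma sum_cell_cones_ge_1:
  assumes gen: "generic c" and c: "\<And>i. 0 < c i \<and> c i \<le> 2"
  shows "1 \<le> (\<Sum>I\<in>cells c. measure gauss_measure (cell_cone I))"
proof -
  have cover: "(\<Union>I\<in>cells c. cell_cone I) = UNIV"
    using cells_cover[OF gen] c by blast
  have "1 = measure gauss_measure (\<Union>I\<in>cells c. cell_cone I)"
    unfolding cover by (rule prob_gauss_UNIV[symmetric])
  also have "\<dots> \<le> (\<Sum>I\<in>cells c. measure gauss_measure (cell_cone I))"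
    using cell_cone_meas by (intro gauss.finite_measure_subadditive_finite finite_cells) (auto simp: cells_def)
  finally show ?thesis .
qed

text \<open>Reordering the sum by generators: the wedges at a fixed a i overlap in null sets, so each
  generator contributes at most the total mass 1.\<close>

lemma sum_cell_wedges_le:
  assumes gen: "generic c"
  shows "(\<Sum>I\<in>cells c. \<Sum>i\<in>I. measure gauss_measure (cell_wedge I i)) \<le> real (card K)"
proof -
  have "(\<Sum>I\<in>cells c. \<Sum>i\<in>I. measure gauss_measure (cell_wedge I i))
      = (\<Sum>I\<in>cells c. \<Sum>i | i \<in> K \<and> i \<in> I. measure gauss_measure (cell_wedge I i))"
    by (intro sum.cong) (auto simp: cells_def bases_def)
  also have "\<dots> = (\<Sum>i\<in>K. \<Sum>I | I \<in> cells c \<and> i \<in> I. measure gauss_measure (cell_wedge I i))"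
    by (intro sum.swap_restrict finite_cells finK)
  also have "\<dots> \<le> (\<Sum>i\<in>K. 1)"
  proof (rule sum_mono)
    fix i assume "i \<in> K"
    have "(\<Sum>I | I \<in> cells c \<and> i \<in> I. measure gauss_measure (cell_wedge I i))
        \<le> measure gauss_measure (UNIV :: (real ^ 'n) set)"
    proof (rule sum_measure_le_if_overlaps_null)
      fix I J assume "I \<in> {I. I \<in> cells c \<and> i \<in> I}" "J \<in> {I. I \<in> cells c \<and> i \<in> I}" "I \<noteq> J"
      then show "measure gauss_measure (cell_wedge I i \<inter> cell_wedge J i) = 0"
        by (intro cells_overlap_null[OF gen, of I J]) (auto intro: cell_wedge_overlap)
    next
      show "finite {I. I \<in> cells c \<and> i \<in> I}"
        using finite_cells by simp
    qed (auto simp: cells_def intro: cell_wedge_meas)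
    then show "(\<Sum>I | I \<in> cells c \<and> i \<in> I. measure gauss_measure (cell_wedge I i)) \<le> 1"
      by (simp add: prob_gauss_UNIV)
  qed
  finally show ?thesis by simp
qed

text \<open>The cells whose vertices coincide for unit heights have almost disjoint cones inside one
  normal cone.\<close>

lemma sum_cells_le_trace:
  assumes gen: "generic c" and sub: "cells c \<subseteq> cells (\<lambda>_. 1)"
  shows "(\<Sum>I\<in>cells c. measure gauss_measure (cell_cone I) * (norm (vertex_of (\<lambda>_. 1) I))\<^sup>2)
    \<le> (\<Sum>v\<in>vert body. gauss_weight body v * (norm v)\<^sup>2)"
proof -
  let ?v = "vertex_of (\<lambda>_. 1)"
  have "(\<Sum>I\<in>cells c. measure gauss_measure (cell_cone I) * (norm (?v I))\<^sup>2)
      = (\<Sum>v\<in>vert body. \<Sum>I | I \<in> cells c \<and> ?v I = v. measure gauss_measure (cell_cone I) * (norm (?v I))\<^sup>2)"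
    using sub vertex_of_in_vert by (intro sum.group[symmetric] finite_cells finite_vert_body) auto
  also have "\<dots> = (\<Sum>v\<in>vert body. (\<Sum>I | I \<in> cells c \<and> ?v I
      = v. measure gauss_measure (cell_cone I)) * (norm v)\<^sup>2)"
    by (intro sum.cong refl) (simp add: sum_distrib_right)
  also have "\<dots> \<le> (\<Sum>v\<in>vert body. gauss_weight body v * (norm v)\<^sup>2)"
  proof (intro sum_mono mult_right_mono)
    fix v assume "v \<in> vert body"
    show "(\<Sum>I | I \<in> cells c \<and> ?v I = v. measure gauss_measure (cell_cone I)) \<le> gauss_weight body v"
      unfolding gauss_weight_def
    proof (rule sum_measure_le_if_overlaps_null)
      show "(\<Union>I\<in>{I. I \<in> cells c \<and> ?v I = v}. cell_cone I) \<subseteq> normal_cone body v"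
        using cell_cone_subset_normal_cone by (auto simp: cells_def)
      fix I J assume "I \<in> {I. I \<in> cells c \<and> ?v I = v}" "J \<in> {I. I \<in> cells c \<and> ?v I = v}" "I \<noteq> J"
      then show "measure gauss_measure (cell_cone I \<inter> cell_cone J) = 0"
        by (intro cells_overlap_null[OF gen, of I J]) (auto intro: cell_cone_overlap)
    next
      show "finite {I. I \<in> cells c \<and> ?v I = v}"
        using finite_cells by simp
    qed (auto simp: cells_def intro: cell_cone_meas borel_closed closed_normal_cone)
  qed simp
  finally show ?thesis .
qed

lemma cell_inequality:
  assumes "I \<in> bases"
  shows "real CARD('n) * (1 + pi / 2) * measure gauss_measure (cell_cone I)
      \<le> measure gauss_measure (cell_cone I) * (norm (vertex_of (\<lambda>_. 1) I))\<^sup>2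
        + pi / 4 * (\<Sum>i\<in>I. measure gauss_measure (cell_wedge I i))"
    and "real CARD('n) * (1 + pi / 2) * measure gauss_measure (cell_cone I)
      = measure gauss_measure (cell_cone I) * (norm (vertex_of (\<lambda>_. 1) I))\<^sup>2
        + pi / 4 * (\<Sum>i\<in>I. measure gauss_measure (cell_wedge I i)) \<Longrightarrow> i \<in> I \<Longrightarrow> a i = dual_vec I i"
proof -
  interpret dual_bases I a "dual_vec I" using assms by (rule dual_bases_dual_vec)
  have "norm (a i) = 1" if "i \<in> I" for i
    using that assms unit by (auto simp: bases_def)
  note * = cone_inequality[OF this, unfolded apex_eq[OF assms]]
  show "real CARD('n) * (1 + pi / 2) * measure gauss_measure (cell_cone I)
      \<le> measure gauss_measure (cell_cone I) * (norm (vertex_of (\<lambda>_. 1) I))\<^sup>2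
        + pi / 4 * (\<Sum>i\<in>I. measure gauss_measure (cell_wedge I i))"
    using *(1) by blast
  show "real CARD('n) * (1 + pi / 2) * measure gauss_measure (cell_cone I)
      = measure gauss_measure (cell_cone I) * (norm (vertex_of (\<lambda>_. 1) I))\<^sup>2
        + pi / 4 * (\<Sum>i\<in>I. measure gauss_measure (cell_wedge I i)) \<Longrightarrow> i \<in> I \<Longrightarrow> a i = dual_vec I i"
    using *(2) by blast
qed

text \<open>Sum the inequality of the simplicial cones. The cones cover the space, their wedges have
  total mass at most card K, and both facts enter with the favourable sign. In the case of equality
  every step is tight: all cells are orthonormal, hence all their vertices have squared norm CARD('n),
  and comparing the two sides gives the number of facets.\<close>

lemma trace_ge_and_tight:
  assumes gen: "generic c" and c: "\<And>i. 0 < c i \<and> c i \<le> 2" and sub: "cells c \<subseteq> cells (\<lambda>_. 1)"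
  defines "T \<equiv> (\<Sum>v\<in>vert body. gauss_weight body v * (norm v)\<^sup>2)"
  shows "real CARD('n) + pi / 4 * (2 * real CARD('n) - real (card K)) \<le> T"
    and "T = real CARD('n) + pi / 4 * (2 * real CARD('n) - real (card K)) \<Longrightarrow>
      card K = 2 * CARD('n) \<and> (\<forall>I\<in>cells c. \<forall>i\<in>I. a i = dual_vec I i)"
proof -
  let ?n = "real CARD('n)"
  let ?P = "\<lambda>I. measure gauss_measure (cell_cone I)"
  let ?R = "\<lambda>I. (norm (vertex_of (\<lambda>_. 1) I))\<^sup>2"
  let ?W = "\<lambda>I. \<Sum>i\<in>I. measure gauss_measure (cell_wedge I i)"
  let ?L = "\<lambda>I. ?n * (1 + pi / 2) * ?P I" and ?G = "\<lambda>I. ?P I * ?R I + pi / 4 * ?W I"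
  define Q where "Q = (\<Sum>I\<in>cells c. ?P I)"
  define \<Theta> where "\<Theta> = (\<Sum>I\<in>cells c. ?W I)"
  define X where "X = (\<Sum>I\<in>cells c. ?P I * ?R I)"
  have Q: "1 \<le> Q" and \<Theta>: "\<Theta> \<le> real (card K)" and X: "X \<le> T"
    unfolding Q_def \<Theta>_def X_def T_def
    using sum_cell_cones_ge_1[OF gen c] sum_cell_wedges_le[OF gen] sum_cells_le_trace[OF gen sub] by auto
  have bas: "I \<in> bases" if "I \<in> cells c" for I
    using that by (simp add: cells_def)
  have le: "?L I \<le> ?G I" if "I \<in> cells c" for I
    by (rule cell_inequality(1)[OF bas[OF that]])
  have sumL: "(\<Sum>I\<in>cells c. ?L I) = ?n * (1 + pi / 2) * Q"
    by (simp add: Q_def sum_distrib_left)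
  have sumG: "(\<Sum>I\<in>cells c. ?G I) = X + pi / 4 * \<Theta>"
    by (simp add: X_def \<Theta>_def sum.distrib sum_distrib_left)
  have LG: "?n * (1 + pi / 2) * Q \<le> X + pi / 4 * \<Theta>"
    using sum_mono[of "cells c" ?L ?G] le unfolding sumL sumG by blast
  have n0: "0 < ?n * (1 + pi / 2)"
    by (simp add: add_pos_pos)
  then have nQ: "?n * (1 + pi / 2) * 1 \<le> ?n * (1 + pi / 2) * Q"
    using Q by (intro mult_left_mono) auto
  have p\<Theta>: "pi / 4 * \<Theta> \<le> pi / 4 * real (card K)"
    using \<Theta> by (intro mult_left_mono) auto
  have goal: "?n + pi / 4 * (2 * ?n - real (card K)) = ?n * (1 + pi / 2) * 1 - pi / 4 * real (card K)"
    by (simp add: field_simps)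
  show "?n + pi / 4 * (2 * ?n - real (card K)) \<le> T"
    unfolding goal using LG nQ p\<Theta> X by linarith
  assume eq: "T = ?n + pi / 4 * (2 * ?n - real (card K))"
  have tight: "?n * (1 + pi / 2) * Q = ?n * (1 + pi / 2) * 1" "X + pi / 4 * \<Theta> = ?n * (1 + pi / 2) * Q"
    "X = T"
    using eq LG nQ p\<Theta> X unfolding goal by linarith+
  have Q1: "Q = 1"
    using tight(1) n0 by (metis mult_left_cancel less_irrefl)
  \<comment> \<open>All differences are nonnegative, so each of them vanishes.\<close>
  have "(\<Sum>I\<in>cells c. ?G I - ?L I) = 0"
    using tight(2) sumL sumG by (simp add: sum_subtractf)
  then have "?G I - ?L I = 0" if "I \<in> cells c" for I
    using that le finite_cells by (subst (asm) sum_nonneg_eq_0_iff) auto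
  then have orth: "a i = dual_vec I i" if "I \<in> cells c" "i \<in> I" for I i
    using that cell_inequality(2)[OF bas] by fastforce
  have R: "?R I = ?n" if I: "I \<in> cells c" for I
  proof -
    interpret dual_bases I a "dual_vec I" using bas[OF I] by (rule dual_bases_dual_vec)
    have "vertex_of (\<lambda>_. 1) I = (\<Sum>i\<in>I. a i)"
      using orth[OF I] by (simp add: vertex_of_def)
    then have "?R I = (\<Sum>i\<in>I. a i) \<bullet> vertex_of (\<lambda>_. 1) I"
      by (simp add: power2_norm_eq_inner)
    also have "\<dots> = (\<Sum>i\<in>I. 1)"
      unfolding inner_sum_left by (intro sum.cong refl a_vertex_of bas I)
    finally show ?thesis
      by (simp add: card_I)
  qed
  have "X = ?n * Q"
    unfolding X_def Q_def sum_distrib_left by (intro sum.cong refl) (simp add: R)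
  then have "?n = ?n + pi / 4 * (2 * ?n - real (card K))"
    using tight(3) eq Q1 by simp
  then have "real (card K) = real (2 * CARD('n))"
    by simp
  then have "card K = 2 * CARD('n)"
    by (simp only: of_nat_eq_iff)
  then show "card K = 2 * CARD('n) \<and> (\<forall>I\<in>cells c. \<forall>i\<in>I. a i = dual_vec I i)"
    using orth by blast
qed

text \<open>Follow the edge of the perturbed polytope that leaves the vertex of I in direction - a i to
  its other end w. The constraint a j that becomes active there belongs, with the remaining generators
  of I, to one cell. This cell is orthonormal, so a j is orthogonal to all of I except a i, and it
  points against a i.\<close>

lemma opposite_normal:
  assumes gen: "generic c" and c: "\<And>i. 0 < c i \<and> c i \<le> 2"
    and orth: "\<And>J j. J \<in> cells c \<Longrightarrow> j \<in> J \<Longrightarrow> a j = dual_vec J j"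
    and I: "I \<in> cells c" "i \<in> I"
  obtains j where "j \<in> K" "a j = - a i"
proof -
  define v where "v = vertex_of c I"
  have bas: "I \<in> bases" and IK: "I \<subseteq> K" and vP: "v \<in> poly_at c"
    using I by (auto simp: cells_def bases_def v_def)
  interpret dual_bases I a "dual_vec I" using bas by (rule dual_bases_dual_vec)
  have dualI: "a k \<bullet> a l = (if k = l then 1 else 0)" if "k \<in> I" "l \<in> I" for k l
    using dual[OF that] orth[OF I(1) that(1)] by simp
  have expandI: "x = (\<Sum>k\<in>I. (a k \<bullet> x) *\<^sub>R a k)" for x
  proof -
    have "x = (\<Sum>k\<in>I. (dual_vec I k \<bullet> x) *\<^sub>R a k)" by (rule expand)
    also have "\<dots> = (\<Sum>k\<in>I. (a k \<bullet> x) *\<^sub>R a k)"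
      using orth[OF I(1)] by (intro sum.cong) auto
    finally show ?thesis .
  qed
  define S where "S = {\<delta>. 0 \<le> \<delta> \<and> v - \<delta> *\<^sub>R a i \<in> poly_at c}"
  have norm_ai: "norm (a i) = 1"
    using unit I(2) IK by blast
  have "closed S"
  proof -
    have "S = {0..} \<inter> (\<lambda>\<delta>. v - \<delta> *\<^sub>R a i) -` poly_at c"
      by (auto simp: S_def)
    then show ?thesis
      by (auto intro!: closed_Int continuous_closed_vimage closed_poly_at continuous_intros)
  qed
  moreover have "bounded S"
  proof -
    obtain B where B: "\<And>x. x \<in> poly_at c \<Longrightarrow> norm x \<le> B"
      using compact_imp_bounded[OF compact_poly_at[of c]] c by (auto simp: bounded_iff)
    have "norm \<delta> \<le> B + norm v" if "\<delta> \<in> S" for \<delta>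
    proof -
      have "norm (\<delta> *\<^sub>R a i) \<le> norm v + norm (v - \<delta> *\<^sub>R a i)"
        using norm_triangle_ineq4[of v "v - \<delta> *\<^sub>R a i"] by simp
      then show ?thesis
        using B[of "v - \<delta> *\<^sub>R a i"] that norm_ai by (simp add: S_def)
    qed
    then show ?thesis
      by (auto simp: bounded_iff)
  qed
  moreover have "S \<noteq> {}"
    using vP by (auto simp: S_def intro!: exI[of _ 0])
  ultimately obtain \<delta> where \<delta>: "\<delta> \<in> S" "\<And>\<eta>. \<eta> \<in> S \<Longrightarrow> \<eta> \<le> \<delta>"
    using compact_attains_sup[of S] by (auto simp: compact_eq_bounded_closed)
  define w where "w = v - \<delta> *\<^sub>R a i"
  have w: "w \<in> poly_at c" and \<delta>0: "0 \<le> \<delta>"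
    using \<delta>(1) by (auto simp: S_def w_def)
  have "\<exists>j\<in>K. a j \<bullet> w = c j \<and> a j \<bullet> a i < 0"
  proof (rule ccontr)
    assume "\<not> ?thesis"
    then have "a j \<bullet> (- a i) \<le> 0" if "j \<in> K" "a j \<bullet> w = c j" for j
      using that by force
    then have "\<forall>\<^sub>F \<eta> in at_right 0. w + \<eta> *\<^sub>R (- a i) \<in> poly_at c \<and> 0 < \<eta>"
      by (intro eventually_conj small_step w eventually_at_right_less)
    then obtain \<eta> where "w + \<eta> *\<^sub>R (- a i) \<in> poly_at c" "0 < \<eta>"
      using eventually_at_right_witness by blast
    then have "\<delta> + \<eta> \<in> S"
      using \<delta>0 by (simp add: S_def w_def algebra_simps)
    then show False
      using \<delta>(2) \<open>0 < \<eta>\<close> by fastforce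
  qed
  then obtain j where j: "j \<in> K" "a j \<bullet> w = c j" "a j \<bullet> a i < 0"
    by blast
  have jI: "j \<notin> I"
    using j(3) dualI[of j i] I(2) by (auto split: if_splits)
  let ?J = "insert j (I - {i})"
  have act: "a k \<bullet> w = c k" if "k \<in> ?J" for k
    using that j(2) a_vertex_of[OF bas, of k c] dualI[of k i] I(2) by (auto simp: w_def v_def inner_simps)
  have single: "y = (a i \<bullet> y) *\<^sub>R a i" if "\<And>k. k \<in> I - {i} \<Longrightarrow> a k \<bullet> y = 0" for y
  proof -
    have "y = (\<Sum>k\<in>I. (a k \<bullet> y) *\<^sub>R a k)" by (rule expandI)
    also have "\<dots> = (a i \<bullet> y) *\<^sub>R a i"
      using that I(2) fin by (simp add: sum.remove[of I i])
    finally show ?thesis .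
  qed
  have "w extreme_point_of poly_at c"
  proof (rule extreme_if_active_span[OF w, of ?J])
    fix y assume y: "\<And>k. k \<in> ?J \<Longrightarrow> a k \<bullet> y = 0"
    have "y = (a i \<bullet> y) *\<^sub>R a i"
      using y by (intro single) auto
    moreover from this have "(a i \<bullet> y) * (a j \<bullet> a i) = 0"
      using y[of j] by (metis inner_scaleR_right insertI1)
    ultimately show "y = 0"
      using j(3) by (metis less_irrefl mult_eq_0_iff scaleR_zero_left)
  qed (use IK j act in auto)
  then obtain J where J: "J \<in> cells c" "w = vertex_of c J"
    using extreme_cell by blast
  have JJ: "?J \<subseteq> J"
    using generic_active[OF gen J(1)] act IK j(1) J(2) by auto
  have "a k \<bullet> a j = 0" if "k \<in> I - {i}" for k
    using dual_bases.dual[OF dual_bases_dual_vec, of J k j] J(1) JJ that jI orth[OF J(1), of k]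
    by (auto simp: cells_def)
  then have aj: "a j = (a i \<bullet> a j) *\<^sub>R a i"
    by (rule single)
  then have "norm (a j) = \<bar>a i \<bullet> a j\<bar>"
    using norm_ai by (metis mult.right_neutral norm_scaleR)
  then have "a i \<bullet> a j = - 1"
    using unit[OF j(1)] j(3) by (simp add: inner_commute)
  then have "a j = - a i"
    using aj by simp
  with j(1) show ?thesis by (rule that)
qed

lemma trace_ge:
  "real CARD('n) + pi / 4 * (2 * real CARD('n) - real (card K))
    \<le> (\<Sum>v\<in>vert body. gauss_weight body v * (norm v)\<^sup>2)"
proof -
  obtain c where "generic c" "\<And>i. 0 < c i \<and> c i \<le> 2" "cells c \<subseteq> cells (\<lambda>_. 1)"
    using exists_good_heights by blast
  then show ?thesis by (rule trace_ge_and_tight(1))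
qed

lemma cube_if_trace_eq:
  assumes inj: "inj_on a K"
    and eq: "(\<Sum>v\<in>vert body. gauss_weight body v * (norm v)\<^sup>2)
      = real CARD('n) + pi / 4 * (2 * real CARD('n) - real (card K))"
  shows "card K = 2 * CARD('n) \<and>
    (\<exists>U :: real ^ 'n \<Rightarrow> real ^ 'n. orthogonal_transformation U \<and> body = U ` cbox (vec (- 1)) (vec 1))"
proof -
  obtain c where c: "generic c" "\<And>i. 0 < c i \<and> c i \<le> 2" "cells c \<subseteq> cells (\<lambda>_. 1)"
    using exists_good_heights by blast
  have cardK: "card K = 2 * CARD('n)" and orth: "\<And>I i. I \<in> cells c \<Longrightarrow> i \<in> I \<Longrightarrow> a i = dual_vec I i"
    using trace_ge_and_tight(2)[OF c eq] by auto
  obtain I where I: "I \<in> cells c"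
    using cells_cover[OF c(1), of 0] c(2) by blast
  have bas: "I \<in> bases" and IK: "I \<subseteq> K"
    using I by (auto simp: cells_def bases_def)
  interpret dual_bases I a "dual_vec I" using bas by (rule dual_bases_dual_vec)
  have frame: "dual_bases I a a"
  proof
    show "a i \<bullet> a j = (if i = j then 1 else 0)" if "i \<in> I" "j \<in> I" for i j
      using dual[OF that] orth[OF I that(1)] by simp
    fix x
    have "x = (\<Sum>i\<in>I. (dual_vec I i \<bullet> x) *\<^sub>R a i)" by (rule expand)
    also have "\<dots> = (\<Sum>i\<in>I. (a i \<bullet> x) *\<^sub>R a i)"
      using orth[OF I] by (intro sum.cong) auto
    finally show "x = (\<Sum>i\<in>I. (a i \<bullet> x) *\<^sub>R a i)" .
  qed (rule fin)
  interpret fr: dual_bases I a a by (rule frame)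
  have injI: "inj_on a I"
    using inj IK by (rule inj_on_subset)
  let ?N = "(\<lambda>i. - a i) ` I"
  have "a ` I \<inter> ?N = {}"
  proof (safe)
    fix i j assume ij: "i \<in> I" "j \<in> I" "a i = - a j"
    then have "a i \<bullet> a i = - (a j \<bullet> a i)"
      by (metis inner_minus_left)
    then show "a i \<in> {}"
      using fr.dual[OF ij(1,1)] fr.dual[OF ij(2,1)] by (auto split: if_splits)
  qed
  moreover have "inj_on (\<lambda>i. - a i) I"
    using injI by (auto simp: inj_on_def)
  ultimately have "card (a ` I \<union> ?N) = 2 * CARD('n)"
    using fin injI by (subst card_Un_disjoint) (auto simp: card_image card_I)
  moreover have sub: "a ` I \<union> ?N \<subseteq> a ` K"
  proof
    fix y assume "y \<in> a ` I \<union> ?N"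
    then consider i where "i \<in> I" "y = a i" | i where "i \<in> I" "y = - a i" by blast
    then show "y \<in> a ` K"
    proof cases
      case 1
      then show ?thesis using IK by blast
    next
      case 2
      obtain j where "j \<in> K" "a j = - a i"
        using opposite_normal[OF c(1,2) orth I 2(1)] by blast
      then show ?thesis using 2(2) by (metis imageI)
    qed
  qed
  moreover have "card (a ` K) = 2 * CARD('n)"
    using inj cardK by (simp add: card_image)
  ultimately have all: "a ` I \<union> ?N = a ` K"
    using finK by (intro card_subset_eq) auto
  have "body = {x. \<forall>y\<in>a ` K. y \<bullet> x \<le> 1}"
    by (auto simp: poly_at_def)
  also have "\<dots> = {x. \<forall>i\<in>I. \<bar>a i \<bullet> x\<bar> \<le> 1}"
    unfolding all[symmetric] by (auto simp: abs_le_iff ball_Un)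
  finally show ?thesis
    using symmetric_frame_cube[OF frame] cardK by metis
qed

lemma trace_eq_if_cube:
  fixes U :: "real ^ 'n \<Rightarrow> real ^ 'n"
  assumes card: "card K = 2 * CARD('n)"
    and U: "orthogonal_transformation U" "body = U ` cbox (vec (- 1)) (vec 1)"
  shows "(\<Sum>v\<in>vert body. gauss_weight body v * (norm v)\<^sup>2)
      = real CARD('n) + pi / 4 * (2 * real CARD('n) - real (card K))"
proof -
  have "(\<Sum>v\<in>vert body. gauss_weight body v * (norm v)\<^sup>2) = (\<Sum>v\<in>vert body. gauss_weight body v * real CARD('n))"
    using norm_vertex_rotated_cube[OF U(1)] U(2) by (intro sum.cong refl) metis
  also have "\<dots> = (\<Sum>v\<in>vert body. gauss_weight body v) * real CARD('n)"
    by (rule sum_distrib_right[symmetric])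
  also have "\<dots> \<le> 1 * real CARD('n)"
    by (intro mult_right_mono sum_gauss_weight_le_1 finite_vert_body) simp
  finally show ?thesis
    using trace_ge card by simp
qed

end

theorem theorem1p2:
  fixes a :: "nat \<Rightarrow> real ^ 'n" and m :: nat and P :: "(real ^ 'n) set"
  assumes distinct: "inj_on a {1..m}"
    and unit: "\<And>i. i \<in> {1..m} \<Longrightarrow> norm (a i) = 1"
    and P_def: "P = {x. \<forall>i\<in>{1..m}. a i \<bullet> x \<le> 1}"
    and bounded: "bounded P"
  shows "operator_trace (second_moment_operator P) = (\<Sum>v\<in>vert P. gauss_weight P v * (norm v)\<^sup>2)
    \<and> (\<Sum>v\<in>vert P. gauss_weight P v * (norm v)\<^sup>2)
        \<ge> real CARD('n) + pi / 4 * (2 * real CARD('n) - real m)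
    \<and> ((\<Sum>v\<in>vert P. gauss_weight P v * (norm v)\<^sup>2)
          = real CARD('n) + pi / 4 * (2 * real CARD('n) - real m)
        \<longleftrightarrow> m = 2 * CARD('n)
            \<and> (\<exists>U :: real ^ 'n \<Rightarrow> real ^ 'n. orthogonal_transformation U \<and> P = U ` cbox (vec (-1)) (vec 1)))"
proof -
  interpret tangential_polytope a "{1..m}"
    using unit bounded unfolding P_def by unfold_locales auto
  have P: "P = body"
    unfolding P_def poly_at_def ..
  have card: "card {1..m} = m" by simp
  show ?thesis
    unfolding P
    using operator_trace_second_moment[of body] trace_ge[unfolded card]
      cube_if_trace_eq[OF distinct, unfolded card] trace_eq_if_cube[unfolded card]
    by blast
qed

end
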